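(* Let $W\subset(\mathbb{R}^2)^\ast$ be the compact convex set with support function $h(x)=\min_{y\in W}\langle x,y\rangle=-\sqrt[6]{x_1^6+x_2^6}$ for $x=(x_1,x_2)^T\in\mathbb{R}^2$. Let $p=x_0^6-x_1^6-x_2^6$, let $D=\{x\in\mathbb{P}^2 : p(x)=0\}$, let $D^\vee\subset(\mathbb{P}^2)^\ast$ be the dual curve to $D$, and let $C=\{(y_1,y_2)\in(\mathbb{R}^2)^\ast : (1:y_1:y_2)\in D^\vee\}$ be the real, affine part of $D^\vee$. Put $\omega=\left(\frac{11+5\sqrt5}{2}\right)^{1/6}\approx 1.49$. Then: (i) For every nonzero $x\in\mathbb{R}^2$, the supporting line of $W$ with inner normal vector $x$ has the pole $(-h(x):x_1:x_2)$, which lies on $D$. The real, affine part $\{(x_1,x_2)^T\in\mathbb{R}^2 : x_1^6+x_2^6=1\}$ of $D$ is the set of (poles of) all supporting lines of $W$. (ii) $D^\vee=\{y\in(\mathbb{P}^2)^\ast : q(y)=0\}$, where $q\in\mathbb{R}[y_0,y_1,y_2]$ is the irreducible, homogeneous polynomial of degree $30$ $$\begin{aligned} q={}&y_0^{30}-5y_1^6y_0^{24}-5y_2^6y_0^{24}+10y_1^{12}y_0^{18}+10y_2^{12}y_0^{18}-605y_1^6y_2^6y_0^{18}-10y_1^{18}y_0^{12}\\ &-10y_2^{18}y_0^{12}-1905y_1^6y_2^{12}y_0^{12}-1905y_1^{12}y_2^6y_0^{12}+5y_1^{24}y_0^6+5y_2^{24}y_0^6-605y_1^6y_2^{18}y_0^6\\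 &+1905y_1^{12}y_2^{12}y_0^6-605y_1^{18}y_2^6y_0^6-y_1^{30}-y_2^{30}-5y_1^6y_2^{24}-10y_1^{12}y_2^{18}-10y_1^{18}y_2^{12}-5y_1^{24}y_2^6\,. \end{aligned}$$ (iii) The curve $D^\vee$ has $228$ singular points, eight of which are real. The real ones are, in affine coordinates $(y_1,y_2)$, the points $(1,0)$, $(0,1)$, $(-1,0)$, $(0,-1)$, $(\omega,\omega)$, $(\omega,-\omega)$, $(-\omega,\omega)$, and $(-\omega,-\omega)$. (iv) $C$ consists of a rounded rhomb (the boundary curve of $W$), which contains the first four of these singular points, and of the four isolated, singular points $(\omega,\omega)$, $(\omega,-\omega)$, $(-\omega,\omega)$, $(-\omega,-\omega)$. (v) The four isolated singular points lie outside of $W$. Hence the analogue of Kippenhahn's assertion fails for $W$: the set $W$ is not the convex hull of $C$. (vi) The polars of the four isolated singular points are real double tangents of the curve $D$, and they intersect the set $\{(x_1,x_2)^T\in\mathbb{R}^2 : x_1^6+x_2^6<1\}$. For example, the polar of $(1:\omega:\omega)\in D^\vee$ is tangent to $D$ at the pair of complex conjugate points $$\frac{1}{2\omega}(-1\pm\mathrm{i}\alpha,\,-1\mp\mathrm{i}\alpha)^T,\qquad \alpha=\sqrt{5+2\sqrt5}\,.$$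
   Context: $\mathbb{P}^2$ is the complex projective plane with homogeneous coordinates $(x_0:x_1:x_2)$ and $(\mathbb{P}^2)^\ast$ is the dual projective plane with homogeneous coordinates $(y_0:y_1:y_2)$. The pairing of $x=(x_1,x_2)^T\in\mathbb{R}^2$ and $y=(y_1,y_2)\in(\mathbb{R}^2)^\ast$ is $\langle x,y\rangle=x_1y_1+x_2y_2$. For a compact convex set $W\subset(\mathbb{R}^2)^\ast$ the support function is taken with a minimum, $h(x)=\min_{y\in W}\langle x,y\rangle$, and the supporting line of $W$ with inner normal vector $x\neq0$ is $\{y\in(\mathbb{R}^2)^\ast : \langle x,y\rangle=h(x)\}$. The affine planes $\mathbb{C}^2$ and $(\mathbb{C}^2)^\ast$ are embedded in $\mathbb{P}^2$ and $(\mathbb{P}^2)^\ast$ via $(x_1,x_2)^T\mapsto(1:x_1:x_2)$ and $(y_1,y_2)\mapsto(1:y_1:y_2)$. The polar of $(x_0:x_1:x_2)\in\mathbb{P}^2$ is the line $\{(y_0:y_1:y_2)\in(\mathbb{P}^2)^\ast : x_0y_0+x_1y_1+x_2y_2=0\}$, and $(x_0:x_1:x_2)$ is the pole of this line; polars (lines in $\mathbb{P}^2$) of points of $(\mathbb{P}^2)^\ast$ are defined analogously. A line is identified with its pole, and it is real if its pole can be written with real coordinates. A point $x$ of a curve $\{p=0\}\subset\mathbb{P}^2$ ($p$ irreducible and homogeneous) is regular if at least one partial derivative of $p$ is nonzero at $x$, and singular otherwise; likewise for curves in $(\mathbb{P}^2)^\ast$. The tangent line to $D$ at a regular point $x$ is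 identified with the point $(\partial_{x_0}p(x):\partial_{x_1}p(x):\partial_{x_2}p(x))\in(\mathbb{P}^2)^\ast$. The dual curve $D^\vee$ is the closure (in the norm topology, equivalently in the Zariski topology) of the set of tangent lines to $D$ at all regular points of $D$. The real, affine part of $D$ is $\{(x_1,x_2)^T\in\mathbb{R}^2 : (1:x_1:x_2)\in D\}$. A double tangent of $D$ is a line tangent to $D$ at two distinct points. A point of $C$ is isolated if it has a neighborhood in $(\mathbb{R}^2)^\ast$ containing no other point of $C$. Kippenhahn's assertion: for hermitian $K,L\in\mathbb{C}^{n\times n}$, the numerical range of $K+\mathrm{i}L$ (viewed as a subset of $(\mathbb{R}^2)^\ast$) is the convex hull of the real, affine part of the dual curve to $\{\det(x_0\mathbb{1}+x_1K+x_2L)=0\}\subset\mathbb{P}^2$.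
   Formalization: In (iii), the number 228 counts the singular points of D^∨ in the affine chart y_0≠0 only; D^∨ also has six singular points (0:y_1:y_2) with y_1^6+y_2^6=0, none of them real, so 228 is false for the whole projective curve. *)

theory Defs
  imports "HOL-Analysis.Analysis" "HOL-Library.Poly_Mapping"
    "HOL-Computational_Algebra.Factorial_Ring"
begin

section \<open>Ternary real polynomials\<close>

text \<open>
  Indices are the elements 0, 1, 2 of the three-element type \<open>3\<close> (in which \<open>3 = 0\<close>), so that they
  agree with the usual numbering \<open>x0, x1, x2\<close> of homogeneous coordinates.  The ring structure on
  \<open>ternary_poly\<close> is the convolution product of \<^theory>\<open>HOL-Library.Poly_Mapping\<close>.
\<close>

type_synonym ternary_poly = "(3 \<Rightarrow>\<^sub>0 nat) \<Rightarrow>\<^sub>0 real"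

definition Var :: "3 \<Rightarrow> ternary_poly" where
  "Var i = Poly_Mapping.single (Poly_Mapping.single i 1) 1"

definition eval_poly :: "ternary_poly \<Rightarrow> complex ^ 3 \<Rightarrow> complex" where
  "eval_poly p v = (\<Sum>m\<in>Poly_Mapping.keys p.
      of_real (Poly_Mapping.lookup p m) * (\<Prod>i\<in>UNIV. (v $ i) ^ Poly_Mapping.lookup m i))"

text \<open>
  The truncated exponent \<open>m i - 1\<close> at \<open>m i = 0\<close> is harmless: the coefficient vanishes there.
\<close>

definition partial_deriv :: "3 \<Rightarrow> ternary_poly \<Rightarrow> ternary_poly" where
  "partial_deriv i p = (\<Sum>m\<in>Poly_Mapping.keys p.
      Poly_Mapping.single (m - Poly_Mapping.single i 1)
        (of_nat (Poly_Mapping.lookup m i) * Poly_Mapping.lookup p m))"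

definition gradient :: "ternary_poly \<Rightarrow> complex ^ 3 \<Rightarrow> complex ^ 3" where
  "gradient p v = (\<chi> i. eval_poly (partial_deriv i p) v)"

definition homogeneous :: "nat \<Rightarrow> ternary_poly \<Rightarrow> bool" where
  "homogeneous d p \<longleftrightarrow>
     (\<forall>m\<in>Poly_Mapping.keys p. (\<Sum>i\<in>UNIV. Poly_Mapping.lookup m i) = d)"

section \<open>The complex projective plane\<close>

definition proj_equiv :: "complex ^ 3 \<Rightarrow> complex ^ 3 \<Rightarrow> bool" where
  "proj_equiv v w \<longleftrightarrow> v \<noteq> 0 \<and> (\<exists>c. c \<noteq> 0 \<and> w = c *s v)"

lemma proj_equiv_part_equivp: "part_equivp proj_equiv"
proof (rule part_equivpI)
  have "(axis 0 1 :: complex ^ 3) \<noteq> 0"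
    by (simp add: axis_eq_0_iff)
  then show "\<exists>v. proj_equiv v v"
    unfolding proj_equiv_def by (metis vector_smult_lid zero_neq_one)
  show "symp proj_equiv"
  proof (rule sympI)
    fix v w assume "proj_equiv v w"
    then obtain c where c: "v \<noteq> 0" "c \<noteq> 0" "w = c *s v"
      by (auto simp: proj_equiv_def)
    then have "v = inverse c *s w" "w \<noteq> 0"
      by (auto simp: vector_smult_assoc)
    with c show "proj_equiv w v"
      unfolding proj_equiv_def by (metis nonzero_imp_inverse_nonzero)
  qed
  show "transp proj_equiv"
  proof (rule transpI)
    fix u v w assume "proj_equiv u v" "proj_equiv v w"
    then obtain c d where "u \<noteq> 0" "c \<noteq> 0" "v = c *s u" "d \<noteq> 0" "w = d *s v"
      by (auto simp: proj_equiv_def)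
    then show "proj_equiv u w"
      unfolding proj_equiv_def by (intro conjI exI[of _ "d * c"]) (auto simp: vector_smult_assoc)
  qed
qed

text \<open>
  One type serves for both the plane and its dual; the pairing of the two is \<open>polar\<close> below.
  \<open>proj v\<close> is the point with homogeneous coordinates \<open>v\<close>; it is meaningful only for \<open>v \<noteq> 0\<close>.
\<close>

quotient_type cp2 = "complex ^ 3" / partial: proj_equiv
  morphisms rep_cp2 proj
  by (rule proj_equiv_part_equivp)

text \<open>The norm topology, i.e. the quotient topology from the nonzero vectors.\<close>

instantiation cp2 :: topological_space
begin

definition open_cp2 :: "cp2 set \<Rightarrow> bool" where
  "open_cp2 U \<longleftrightarrow> open {v. v \<noteq> 0 \<and> proj v \<in> U}"

instance
proof
  have "{v :: complex ^ 3. v \<noteq> 0 \<and> proj v \<in> UNIV} = - {0}"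
    by auto
  then show "open (UNIV :: cp2 set)"
    by (simp add: open_cp2_def open_Compl)
next
  fix S T :: "cp2 set" assume "open S" "open T"
  moreover have "{v. v \<noteq> 0 \<and> proj v \<in> S \<inter> T}
      = {v. v \<noteq> 0 \<and> proj v \<in> S} \<inter> {v. v \<noteq> 0 \<and> proj v \<in> T}"
    by auto
  ultimately show "open (S \<inter> T)"
    by (simp add: open_cp2_def open_Int)
next
  fix K :: "cp2 set set" assume "\<forall>S\<in>K. open S"
  moreover have "{v. v \<noteq> 0 \<and> proj v \<in> \<Union>K} = (\<Union>S\<in>K. {v. v \<noteq> 0 \<and> proj v \<in> S})"
    by auto
  ultimately show "open (\<Union>K)"
    by (simp add: open_cp2_def open_UN)
qed

end

definition hom_coords :: "complex \<Rightarrow> complex \<Rightarrow> complex \<Rightarrow> complex ^ 3" where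
  "hom_coords a b c = (\<chi> i. if i = 0 then a else if i = 1 then b else c)"

definition affine_point :: "complex ^ 2 \<Rightarrow> cp2" where
  "affine_point x = proj (hom_coords 1 (x $ 1) (x $ 2))"

definition real_affine_point :: "real ^ 2 \<Rightarrow> cp2" where
  "real_affine_point x = affine_point (\<chi> i. of_real (x $ i))"

definition real_affine_part :: "cp2 set \<Rightarrow> (real ^ 2) set" where
  "real_affine_part S = {x. real_affine_point x \<in> S}"

definition is_real :: "cp2 \<Rightarrow> bool" where
  "is_real z \<longleftrightarrow> (\<exists>v :: real ^ 3. v \<noteq> 0 \<and> z = proj (\<chi> i. of_real (v $ i)))"

definition polar :: "cp2 \<Rightarrow> cp2 set" where
  "polar z = {w. \<exists>u v. u \<noteq> 0 \<and> v \<noteq> 0 \<and> z = proj u \<and> w = proj v \<and> (\<Sum>i\<in>UNIV. u $ i * v $ i) = 0}"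

definition real_line :: "cp2 set \<Rightarrow> bool" where
  "real_line l \<longleftrightarrow> (\<exists>z. is_real z \<and> l = polar z)"

text \<open>
  A line in the real affine plane is identified with the projective line of which it is the
  real, affine part; two distinct real points on it determine the pole.
\<close>

definition is_pole_of_real_affine_line :: "cp2 \<Rightarrow> (real ^ 2) set \<Rightarrow> bool" where
  "is_pole_of_real_affine_line z l \<longleftrightarrow> real_affine_part (polar z) = l"

section \<open>Plane curves\<close>

text \<open>
  A curve is given by its (irreducible, homogeneous) defining polynomial, which enters the notion
  of a regular point.
\<close>

definition curve :: "ternary_poly \<Rightarrow> cp2 set" where
  "curve p = {x. \<exists>v. v \<noteq> 0 \<and> x = proj v \<and> eval_poly p v = 0}"

definition singular_points :: "ternary_poly \<Rightarrow> cp2 set" where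
  "singular_points p =
     {x. \<exists>v. v \<noteq> 0 \<and> x = proj v \<and> eval_poly p v = 0 \<and> gradient p v = 0}"

text \<open>\<open>tangent_at p x y\<close>: \<open>x\<close> is a regular point of the curve and \<open>y\<close> is the pole of its tangent line.\<close>

definition tangent_at :: "ternary_poly \<Rightarrow> cp2 \<Rightarrow> cp2 \<Rightarrow> bool" where
  "tangent_at p x y \<longleftrightarrow>
     (\<exists>v. v \<noteq> 0 \<and> x = proj v \<and> eval_poly p v = 0 \<and> gradient p v \<noteq> 0 \<and> y = proj (gradient p v))"

definition dual_curve :: "ternary_poly \<Rightarrow> cp2 set" where
  "dual_curve p = closure {y. \<exists>x. tangent_at p x y}"

definition line_tangent_at :: "ternary_poly \<Rightarrow> cp2 set \<Rightarrow> cp2 \<Rightarrow> bool" where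
  "line_tangent_at p l x \<longleftrightarrow> (\<exists>y. tangent_at p x y \<and> l = polar y)"

definition double_tangent :: "ternary_poly \<Rightarrow> cp2 set \<Rightarrow> bool" where
  "double_tangent p l \<longleftrightarrow> (\<exists>x x'. x \<noteq> x' \<and> line_tangent_at p l x \<and> line_tangent_at p l x')"

section \<open>Support functions\<close>

text \<open>For compact nonempty \<open>W\<close> the infimum is a minimum.\<close>

definition support_fun :: "(real ^ 2) set \<Rightarrow> real ^ 2 \<Rightarrow> real" where
  "support_fun W x = (INF y\<in>W. x \<bullet> y)"

definition supporting_line :: "(real ^ 2) set \<Rightarrow> real ^ 2 \<Rightarrow> (real ^ 2) set" where
  "supporting_line W x = {y. x \<bullet> y = support_fun W x}"

section \<open>The sextic and its dual\<close>

definition p_sextic :: ternary_poly where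
  "p_sextic = Var 0 ^ 6 - Var 1 ^ 6 - Var 2 ^ 6"

definition q_dual :: ternary_poly where
  "q_dual = (let y0 = Var 0; y1 = Var 1; y2 = Var 2 in
     y0^30 - 5 * y1^6 * y0^24 - 5 * y2^6 * y0^24 + 10 * y1^12 * y0^18 + 10 * y2^12 * y0^18
     - 605 * y1^6 * y2^6 * y0^18 - 10 * y1^18 * y0^12
     - 10 * y2^18 * y0^12 - 1905 * y1^6 * y2^12 * y0^12 - 1905 * y1^12 * y2^6 * y0^12
     + 5 * y1^24 * y0^6 + 5 * y2^24 * y0^6 - 605 * y1^6 * y2^18 * y0^6
     + 1905 * y1^12 * y2^12 * y0^6 - 605 * y1^18 * y2^6 * y0^6 - y1^30 - y2^30
     - 5 * y1^6 * y2^24 - 10 * y1^12 * y2^18 - 10 * y1^18 * y2^12 - 5 * y1^24 * y2^6)"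

definition \<omega> :: real where
  "\<omega> = root 6 ((11 + 5 * sqrt 5) / 2)"

definition \<alpha> :: real where
  "\<alpha> = sqrt (5 + 2 * sqrt 5)"

definition axis_points :: "(real ^ 2) set" where
  "axis_points = {vector [1, 0], vector [0, 1], vector [-1, 0], vector [0, -1]}"

definition diagonal_points :: "(real ^ 2) set" where
  "diagonal_points = {vector [\<omega>, \<omega>], vector [\<omega>, -\<omega>], vector [-\<omega>, \<omega>], vector [-\<omega>, -\<omega>]}"

end

theory Submission
  imports Defs "HOL-Computational_Algebra.Polynomial_Factorial"
    "HOL-Computational_Algebra.Field_as_Ring"
    "HOL-Computational_Algebra.Fundamental_Theorem_Algebra"
begin

text \<open>
  The gradient map sends a point \<open>x\<close> of the sextic to \<open>(x0\<^sup>5 : - x1\<^sup>5 : - x2\<^sup>5)\<close>.  In the coordinates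
  \<open>u\<^sub>i = y\<^sub>i\<^sup>6 = (x\<^sub>i\<^sup>6)\<^sup>5\<close> the dual curve is therefore the image of the line \<open>s\<^sub>0 = s\<^sub>1 + s\<^sub>2\<close> under
  \<open>s \<mapsto> s\<^sup>5\<close>, a rational quintic whose equation is the norm of \<open>s\<^sub>0 - s\<^sub>1 - s\<^sub>2\<close> over the fifth roots of
  unity.  Its gradient vanishes only at the six nodes where two parameters collide, each of which
  carries 36 points \<open>y\<close>; the remaining singular points lie on the coordinate lines, where
  \<open>y \<mapsto> u\<close> ramifies.  A real point of the dual curve is a solution of \<open>1 = a s\<^sub>1 + b s\<^sub>2\<close> with
  \<open>s\<^sub>1, s\<^sub>2 \<ge> 0\<close> and fifth roots of unity \<open>a, b\<close>, which forces \<open>s\<^sub>1 + s\<^sub>2 = 1\<close>, the boundary of the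
  unit ball of the \<open>6/5\<close>-norm, or \<open>s\<^sub>1 = s\<^sub>2 = (1 + \<surd>5) / 2\<close>.  For irreducibility, one of two factors
  of the dual polynomial vanishes on all tangents, since the sextic is irreducible by Eisenstein's
  criterion, and some line meets the dual curve in 30 distinct points, so that factor has full degree.
\<close>

section \<open>Evaluation in commutative rings\<close>

text \<open>Three rings occur. Statements about points need complex values, but irreducibility is
  settled in \<open>complex poly poly\<close>, where unique factorisation makes the irreducible
  sextic a prime element, and in \<open>ternary_poly poly\<close>, where the degree in
  \<open>y0\<close> is visible. Hence evaluation has a variable coefficient map and target ring, and
  \<open>quintic\<close> is defined over any integral domain. All constants come from the regular
  pentagon. Up to permuting the three coordinates with signs, a node arises when s/t is a primitive
  fifth root of unity \<zeta>, and (1 + \<zeta>)^5 is then a root of z^2 + 11 z - 1. With the golden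
  ratio g = (1 + sqrt 5)/2 these roots are - g^5 and g^-5, and \<omega>^6 = g^5. The count 228 is 6
  * 36 + 2 * 6: the nodes, and the contact points with y1 = 0 and y2 = 0. The contact points with y0
  = 0, where y1^6 = - y2^6, are six further singular points; they are neither affine nor
  real.\<close>

definition eval_hom :: "(real \<Rightarrow> 'r) \<Rightarrow> (3 \<Rightarrow> 'r) \<Rightarrow> ternary_poly \<Rightarrow> 'r::comm_ring_1" where
  "eval_hom h v p = (\<Sum>m\<in>Poly_Mapping.keys p.
      h (Poly_Mapping.lookup p m) * (\<Prod>i\<in>UNIV. v i ^ Poly_Mapping.lookup m i))"

lemma eval_poly_eq_eval_hom: "eval_poly p v = eval_hom of_real (($) v) p"
  by (simp add: eval_poly_def eval_hom_def)

locale coeff_hom =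
  fixes h :: "real \<Rightarrow> 'r::comm_ring_1"
  assumes h_0: "h 0 = 0" and h_1: "h 1 = 1"
    and h_add: "h (a + b) = h a + h b" and h_mult: "h (a * b) = h a * h b"
begin

lemma eval_hom_superset:
  assumes "finite S" "Poly_Mapping.keys p \<subseteq> S"
  shows "eval_hom h v p = (\<Sum>m\<in>S. h (Poly_Mapping.lookup p m) * (\<Prod>i\<in>UNIV. v i ^ Poly_Mapping.lookup m i))"
  unfolding eval_hom_def using assms
  by (intro sum.mono_neutral_left) (auto simp: in_keys_iff h_0)

lemma eval_hom_zero: "eval_hom h v 0 = 0"
  by (simp add: eval_hom_def)

lemma eval_hom_single:
  "eval_hom h v (Poly_Mapping.single m c) = h c * (\<Prod>i\<in>UNIV. v i ^ Poly_Mapping.lookup m i)"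
  by (simp add: eval_hom_def h_0)

lemma eval_hom_add: "eval_hom h v (p + q) = eval_hom h v p + eval_hom h v q"
proof -
  let ?S = "Poly_Mapping.keys p \<union> Poly_Mapping.keys q"
  have "Poly_Mapping.keys (p + q) \<subseteq> ?S" by (rule keys_add)
  then show ?thesis
    by (simp add: eval_hom_superset[of ?S] lookup_add h_add algebra_simps sum.distrib)
qed

lemma eval_hom_sum: "eval_hom h v (\<Sum>x\<in>A. f x) = (\<Sum>x\<in>A. eval_hom h v (f x))"
  by (induction A rule: infinite_finite_induct) (simp_all add: eval_hom_zero eval_hom_add)

end

lemma poly_mapping_eq_sum_single:
  fixes p :: "'a \<Rightarrow>\<^sub>0 'b::comm_monoid_add"
  shows "p = (\<Sum>m\<in>Poly_Mapping.keys p. Poly_Mapping.single m (Poly_Mapping.lookup p m))"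
  by (rule poly_mapping_eqI)
    (simp add: lookup_sum lookup_single when_def in_keys_iff)

context coeff_hom
begin

lemma eval_hom_mult: "eval_hom h v (p * q) = eval_hom h v p * eval_hom h v q"
proof -
  have "p * q = (\<Sum>m\<in>Poly_Mapping.keys p. \<Sum>n\<in>Poly_Mapping.keys q.
      Poly_Mapping.single (m + n) (Poly_Mapping.lookup p m * Poly_Mapping.lookup q n))"
    by (subst poly_mapping_eq_sum_single[of p], subst poly_mapping_eq_sum_single[of q])
      (simp add: sum_product mult_single)
  then show ?thesis
    by (simp add: eval_hom_sum eval_hom_single h_mult lookup_add power_add prod.distrib
        eval_hom_def[of h v p] eval_hom_def[of h v q] sum_product algebra_simps)
qed

lemma eval_hom_one: "eval_hom h v 1 = 1"
  by (simp add: eval_hom_def h_1)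

lemma eval_hom_power: "eval_hom h v (p ^ n) = eval_hom h v p ^ n"
  by (induction n) (simp_all add: eval_hom_one eval_hom_mult)

lemma eval_hom_uminus: "eval_hom h v (- p) = - eval_hom h v p"
  using eval_hom_add[of v p "- p"] by (simp add: eval_hom_zero add_eq_0_iff)

lemma eval_hom_diff: "eval_hom h v (p - q) = eval_hom h v p - eval_hom h v q"
  using eval_hom_add[of v p "- q"] by (simp add: eval_hom_uminus)

lemma eval_hom_of_nat: "eval_hom h v (of_nat n) = of_nat n"
  by (induction n) (simp_all add: eval_hom_zero eval_hom_one eval_hom_add)

lemma eval_hom_numeral: "eval_hom h v (numeral n) = numeral n"
  using eval_hom_of_nat[of v "numeral n"] by simp

lemma eval_hom_Var: "eval_hom h v (Var i) = v i"
proof -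
  have "(\<Prod>j\<in>UNIV. v j ^ Poly_Mapping.lookup (Poly_Mapping.single i (1::nat)) j)
      = (\<Prod>j\<in>UNIV. if j = i then v i else 1)"
    by (intro prod.cong) (auto simp: lookup_single when_def)
  then show ?thesis
    by (simp add: Var_def eval_hom_single h_1)
qed

lemmas eval_hom_simps = eval_hom_zero eval_hom_one eval_hom_add eval_hom_mult eval_hom_power
  eval_hom_uminus eval_hom_diff eval_hom_numeral eval_hom_Var

end

text \<open>A ring homomorphism commutes with substitution. This is how divisibility in a polynomial
  ring, with indeterminate coordinates, becomes vanishing at a point.\<close>

lemma eval_hom_compose:
  assumes h: "coeff_hom h" and add: "\<And>a b. \<phi> (a + b) = \<phi> a + \<phi> b"
    and mult: "\<And>a b. \<phi> (a * b) = \<phi> a * \<phi> b" and "\<phi> 0 = 0" "\<phi> 1 = 1"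
  shows "\<phi> (eval_hom h v p) = eval_hom (\<phi> \<circ> h) (\<phi> \<circ> v) p"
proof -
  have sum: "\<phi> (\<Sum>x\<in>A. f x) = (\<Sum>x\<in>A. \<phi> (f x))" for f and A :: "(3 \<Rightarrow>\<^sub>0 nat) set"
    by (induction A rule: infinite_finite_induct) (simp_all add: assms)
  have prod: "\<phi> (\<Prod>x\<in>A. f x) = (\<Prod>x\<in>A. \<phi> (f x))" for f and A :: "3 set"
    by (induction A rule: infinite_finite_induct) (simp_all add: assms)
  have power: "\<phi> (a ^ n) = \<phi> a ^ n" for a n
    by (induction n) (simp_all add: assms)
  show ?thesis
    by (simp add: eval_hom_def sum prod power mult)
qed

lemma coeff_hom_single: "coeff_hom (\<lambda>c. Poly_Mapping.single 0 c :: ternary_poly)"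
  by unfold_locales (simp_all add: single_add mult_single)

lemma eval_hom_id: "eval_hom (Poly_Mapping.single 0) Var p = p"
proof -
  interpret coeff_hom "\<lambda>c. Poly_Mapping.single 0 c :: ternary_poly"
    by (rule coeff_hom_single)
  have pow: "Var i ^ n = Poly_Mapping.single (Poly_Mapping.single i n) 1" for i n
    by (induction n) (simp_all add: Var_def mult_single flip: single_add)
  have monom: "(\<Prod>i\<in>UNIV. Var i ^ Poly_Mapping.lookup m i) = Poly_Mapping.single m (1::real)" for m
  proof -
    have "(\<Prod>i\<in>A. Poly_Mapping.single (f i) (1::real)) = Poly_Mapping.single (\<Sum>i\<in>A. f i) 1"
      for f :: "3 \<Rightarrow> (3 \<Rightarrow>\<^sub>0 nat)" and A
      by (induction A rule: infinite_finite_induct) (simp_all add: mult_single)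
    moreover have "(\<Sum>i\<in>UNIV. Poly_Mapping.single i (Poly_Mapping.lookup m i)) = m"
      by (rule poly_mapping_eqI) (simp add: lookup_sum lookup_single when_def)
    ultimately show ?thesis by (simp add: pow)
  qed
  show ?thesis
    by (subst (2) poly_mapping_eq_sum_single[of p])
      (simp add: eval_hom_def monom mult_single)
qed

interpretation of_real_complex: coeff_hom "of_real :: real \<Rightarrow> complex"
  by unfold_locales simp_all

lemmas eval_poly_simps = of_real_complex.eval_hom_simps[of "($) v" for v, folded eval_poly_eq_eval_hom]

section \<open>Partial derivatives\<close>

text \<open>Ties the formal derivative to the analytic one along a coordinate, so that gradients can
  be computed by derivative rules from closed forms, without expanding coefficients.\<close>

lemma eval_poly_has_field_derivative:
  "((\<lambda>z. eval_poly p (\<chi> j. if j = i then z else v $ j))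
     has_field_derivative eval_poly (partial_deriv i p) v) (at (v $ i))"
proof -
  let ?l = Poly_Mapping.lookup
  have split: "(\<Prod>j\<in>UNIV. w j ^ ?l m j) = w i ^ ?l m i * (\<Prod>j\<in>UNIV - {i}. w j ^ ?l m j)"
    for w :: "3 \<Rightarrow> complex" and m
    by (simp add: prod.remove)
  have fun_eq: "eval_poly p (\<chi> j. if j = i then z else v $ j) =
      (\<Sum>m\<in>Poly_Mapping.keys p. of_real (?l p m) * (z ^ ?l m i * (\<Prod>j\<in>UNIV - {i}. v $ j ^ ?l m j)))" for z
    unfolding eval_poly_def by (intro sum.cong refl) (simp add: split)
  have der_eq: "eval_poly (partial_deriv i p) v =
      (\<Sum>m\<in>Poly_Mapping.keys p. of_real (?l p m) *
        (of_nat (?l m i) * (v $ i) ^ (?l m i - 1) * (\<Prod>j\<in>UNIV - {i}. v $ j ^ ?l m j)))"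
  proof -
    have "eval_poly (Poly_Mapping.single (m - Poly_Mapping.single i 1) (of_nat (?l m i) * ?l p m)) v =
        of_real (?l p m) *
        (of_nat (?l m i) * (v $ i) ^ (?l m i - 1) * (\<Prod>j\<in>UNIV - {i}. v $ j ^ ?l m j))" for m
    proof -
      have "(\<Prod>j\<in>UNIV - {i}. v $ j ^ ?l (m - Poly_Mapping.single i 1) j)
          = (\<Prod>j\<in>UNIV - {i}. v $ j ^ ?l m j)"
        by (rule prod.cong) (simp_all add: lookup_minus lookup_single)
      then show ?thesis
        unfolding eval_poly_eq_eval_hom of_real_complex.eval_hom_single split
        by (simp add: lookup_minus)
    qed
    then show ?thesis
      by (simp add: partial_deriv_def eval_poly_eq_eval_hom of_real_complex.eval_hom_sum)
  qed
  have monom_deriv: "((\<lambda>z. c * (z ^ n * k)) has_field_derivative c * (of_nat n * x ^ (n - 1) * k)) (at x)"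
    for c k x :: complex and n
    by (rule DERIV_cmult, rule DERIV_cmult_right) (auto intro!: derivative_eq_intros)
  show ?thesis
    unfolding fun_eq der_eq by (rule DERIV_sum) (rule monom_deriv)
qed

lemma gradient_nth_eqI:
  assumes "((\<lambda>z. eval_poly p (\<chi> j. if j = i then z else v $ j)) has_field_derivative D) (at (v $ i))"
  shows "gradient p v $ i = D"
  using DERIV_unique[OF eval_poly_has_field_derivative assms] by (simp add: gradient_def)

lemma continuous_on_eval_poly: "continuous_on S (eval_poly p)"
  unfolding eval_poly_def[abs_def] by (intro continuous_intros)

section \<open>Homogeneity\<close>

lemma homogeneous_Var: "homogeneous 1 (Var i)"
  by (auto simp: homogeneous_def Var_def lookup_single when_def)

lemma homogeneous_add: "homogeneous d p \<Longrightarrow> homogeneous d q \<Longrightarrow> homogeneous d (p + q)"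
  using keys_add[of p q] unfolding homogeneous_def by (meson Un_iff subsetD)

lemma homogeneous_diff: "homogeneous d p \<Longrightarrow> homogeneous d q \<Longrightarrow> homogeneous d (p - q)"
  unfolding homogeneous_def
proof
  fix m assume p: "\<forall>m\<in>Poly_Mapping.keys p. (\<Sum>i\<in>UNIV. Poly_Mapping.lookup m i) = d"
    and q: "\<forall>m\<in>Poly_Mapping.keys q. (\<Sum>i\<in>UNIV. Poly_Mapping.lookup m i) = d"
    and "m \<in> Poly_Mapping.keys (p - q)"
  then have "m \<in> Poly_Mapping.keys p \<or> m \<in> Poly_Mapping.keys q"
    by (auto simp: in_keys_iff lookup_minus)
  with p q show "(\<Sum>i\<in>UNIV. Poly_Mapping.lookup m i) = d"
    by blast
qed

lemma homogeneous_mult: "homogeneous d p \<Longrightarrow> homogeneous e q \<Longrightarrow> homogeneous (d + e) (p * q)"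
  unfolding homogeneous_def
proof
  fix m assume p: "\<forall>m\<in>Poly_Mapping.keys p. (\<Sum>i\<in>UNIV. Poly_Mapping.lookup m i) = d"
    and q: "\<forall>m\<in>Poly_Mapping.keys q. (\<Sum>i\<in>UNIV. Poly_Mapping.lookup m i) = e"
    and "m \<in> Poly_Mapping.keys (p * q)"
  then obtain a b where "a \<in> Poly_Mapping.keys p" "b \<in> Poly_Mapping.keys q" "m = a + b"
    using keys_mult[of p q] by blast
  with p q show "(\<Sum>i\<in>UNIV. Poly_Mapping.lookup m i) = d + e"
    by (simp add: lookup_add sum.distrib)
qed

lemma homogeneous_one: "homogeneous 0 1"
  by (simp add: homogeneous_def)

lemma homogeneous_power: "homogeneous d p \<Longrightarrow> homogeneous (n * d) (p ^ n)"
  by (induction n) (auto simp: homogeneous_one intro: homogeneous_mult)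

lemma homogeneous_numeral: "homogeneous 0 (numeral n)"
proof -
  have "homogeneous 0 (of_nat k)" for k
    by (induction k) (auto simp: homogeneous_def[of _ 0] homogeneous_one intro: homogeneous_add)
  from this[of "numeral n"] show ?thesis by simp
qed

section \<open>The quintic\<close>

definition quintic :: "'a::idom \<Rightarrow> 'a \<Rightarrow> 'a \<Rightarrow> 'a" where
  "quintic z a b = z^5 - 5 * (a+b) * z^4 + (10 * a^2 + 10 * b^2 - 605 * a * b) * z^3
     - (10 * a^3 + 10 * b^3 + 1905 * a * b^2 + 1905 * a^2 * b) * z^2
     + (5 * a^4 + 5 * b^4 - 605 * a * b^3 + 1905 * a^2 * b^2 - 605 * a^3 * b) * z - (a+b)^5"

text \<open>The partial derivatives of \<open>quintic\<close>, in \<open>z\<close> here and in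
  \<open>a\<close> below. The one in \<open>b\<close> is \<open>quintic_a z b a\<close>, because
  \<open>quintic\<close> is symmetric in \<open>a\<close> and \<open>b\<close>.\<close>

definition quintic_z :: "'a::idom \<Rightarrow> 'a \<Rightarrow> 'a \<Rightarrow> 'a" where
  "quintic_z z a b = 5 * z^4 - 20 * (a+b) * z^3 + 3 * (10 * a^2 + 10 * b^2 - 605 * a * b) * z^2
     - 2 * (10 * a^3 + 10 * b^3 + 1905 * a * b^2 + 1905 * a^2 * b) * z
     + (5 * a^4 + 5 * b^4 - 605 * a * b^3 + 1905 * a^2 * b^2 - 605 * a^3 * b)"

definition quintic_a :: "'a::idom \<Rightarrow> 'a \<Rightarrow> 'a \<Rightarrow> 'a" where
  "quintic_a z a b = - 5 * z^4 + (20 * a - 605 * b) * z^3 - (30 * a^2 + 1905 * b^2 + 3810 * a * b) * z^2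
     + (20 * a^3 - 605 * b^3 + 3810 * a * b^2 - 1815 * a^2 * b) * z - 5 * (a+b)^4"

lemma quintic_commute: "quintic z b a = quintic z a b"
  by (simp add: quintic_def algebra_simps)

lemma quintic_param: "quintic ((s + t)^5) (s^5) (t^5) = 0"
  unfolding quintic_def by algebra

text \<open>The fifth cyclotomic polynomial, homogenised.\<close>

definition cyclo5 :: "'a::idom \<Rightarrow> 'a \<Rightarrow> 'a" where
  "cyclo5 s t = s^4 + s^3 * t + s^2 * t^2 + s * t^3 + t^4"

text \<open>The derivative of a monic polynomial at a root is the product of the differences from
  the other roots, here (s + \<zeta> t)^5 with \<zeta> a primitive fifth root of unity. Each
  difference of fifth powers splits into linear factors. The powers of s and t account for contact
  with the coordinate lines, the cyclotomic factors for the nodes.\<close>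

lemma quintic_z_param:
  "quintic_z ((s + t)^5) (s^5) (t^5) =
     3125 * s^4 * t^4 * cyclo5 s t * cyclo5 (s + t) (- s) * cyclo5 (s + t) (- t)"
  unfolding quintic_z_def cyclo5_def by algebra

lemma cyclo5_mult: "(s - t) * cyclo5 s t = s^5 - t^5"
  unfolding cyclo5_def by algebra

text \<open>The five values of \<open>(s + \<zeta> t)\<^sup>5\<close>, paired as \<open>\<zeta>\<close> with \<open>\<zeta>\<^sup>-\<^sup>1\<close>, are the roots.\<close>

lemma quintic_factor:
  fixes f :: "'a::idom"
  assumes "f^2 = 1 - f"
  defines "quad \<equiv> \<lambda>z s t f. z^2 - (2 * (s^5+t^5) + 5 * s * t * (s^3+t^3) * f - 10 * s^2 * t^2 * (s+t) * (1+f)) * z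
      + (s^2 + f * s * t + t^2)^5"
  shows "quintic z (s^5) (t^5) = (z - (s+t)^5) * (quad z s t f * quad z s t (-1-f))"
proof -
  \<comment> \<open>\<open>f\<close> and \<open>-1-f\<close> are the two values of \<zeta> +
    \<zeta>^-1. Each quadratic factor is U + V f for its own value of f, with common U and V, so the
    product is the norm U^2 - U V - V^2, which is free of \<open>f\<close>.\<close>
  define U where "U = z^2 - (2 * (s^5+t^5) - 10 * s^2 * t^2 * (s+t)) * z + ((s^2+t^2)^5
    + 10 * (s^2+t^2)^3 * (s * t)^2 - 10 * (s^2+t^2)^2 * (s * t)^3 + 10 * (s^2+t^2) * (s * t)^4 - 3 * (s * t)^5)"
  define V where "V = - (5 * s * t * (s^3+t^3) - 10 * s^2 * t^2 * (s+t)) * z + (5 * (s^2+t^2)^4 * (s * t)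
    - 10 * (s^2+t^2)^3 * (s * t)^2 + 20 * (s^2+t^2)^2 * (s * t)^3 - 15 * (s^2+t^2) * (s * t)^4 + 5 * (s * t)^5)"
  have pow5: "(m + g * n)^5 = (m^5 + 10 * m^3 * n^2 - 10 * m^2 * n^3 + 10 * m * n^4 - 3 * n^5)
      + (5 * m^4 * n - 10 * m^3 * n^2 + 20 * m^2 * n^3 - 15 * m * n^4 + 5 * n^5) * g"
    if "g^2 = 1 - g" for m n g :: 'a
    using that by algebra
  have quad: "quad z s t g = U + V * g" if g: "g^2 = 1 - g" for g
  proof -
    have eq: "s^2 + g * s * t + t^2 = (s^2+t^2) + g * (s * t)"
      by (simp add: algebra_simps)
    show ?thesis
      unfolding quad_def U_def V_def eq pow5[OF g] by algebra
  qed
  have "(-1-f)^2 = 1 - (-1-f)"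
    using assms(1) by algebra
  then have "quad z s t f * quad z s t (-1-f) = (U + V * f) * (U + V * (-1-f))"
    by (simp only: quad[OF assms(1)] quad)
  also have "\<dots> = U^2 - U * V - V^2"
    using assms(1) by algebra
  finally have "quad z s t f * quad z s t (-1-f) = U^2 - U * V - V^2" .
  moreover have "quintic z (s^5) (t^5) = (z - (s+t)^5) * (U^2 - U * V - V^2)"
    unfolding quintic_def U_def V_def by algebra
  ultimately show ?thesis by simp
qed


section \<open>Zeros of the quintic over the complex numbers\<close>

lemma primitive_fifth_root: "\<exists>\<zeta>::complex. \<zeta> \<noteq> 1 \<and> \<zeta>^5 = 1"
proof -
  have "card {z::complex. z^5 = 1} = 5"
    by (rule card_roots_unity_eq) simp
  moreover have "{z::complex. z^5 = 1} \<subseteq> {1} \<Longrightarrow> card {z::complex. z^5 = 1} \<le> card {1::complex}"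
    by (rule card_mono) auto
  ultimately show ?thesis by force
qed

lemma quintic_eq_0_iff_fifth_powers:
  fixes u\<^sub>0 s t :: complex
  shows "quintic u\<^sub>0 (s^5) (t^5) = 0 \<longleftrightarrow> (\<exists>c. c^5 = 1 \<and> u\<^sub>0 = (s + c * t)^5)"
proof
  assume "\<exists>c. c^5 = 1 \<and> u\<^sub>0 = (s + c * t)^5"
  then obtain c where "c^5 = 1" "u\<^sub>0 = (s + c * t)^5" by blast
  then show "quintic u\<^sub>0 (s^5) (t^5) = 0"
    using quintic_param[of s "c * t"] by (simp add: power_mult_distrib)
next
  assume 0: "quintic u\<^sub>0 (s^5) (t^5) = 0"
  obtain \<zeta> :: complex where \<zeta>: "\<zeta> \<noteq> 1" "\<zeta>^5 = 1"
    using primitive_fifth_root by blast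
  have cyc: "\<zeta>^4 + \<zeta>^3 + \<zeta>^2 + \<zeta> + 1 = 0"
  proof -
    have "(\<zeta> - 1) * (\<zeta>^4 + \<zeta>^3 + \<zeta>^2 + \<zeta> + 1) = 0"
      using \<zeta>(2) by algebra
    with \<zeta>(1) show ?thesis by simp
  qed
  \<comment> \<open>The premises are the power sums of a fifth root of unity c and its inverse d.
    They determine the sum and the product of (s + c t)^5 and (s + d t)^5.\<close>
  have pair: "z^2 - (2 * (s^5+t^5) + 5 * s * t * (s^3+t^3) * f - 10 * s^2 * t^2 * (s+t) * (1+f)) * z
      + (s^2 + f * s * t + t^2)^5 = (z - (s + c * t)^5) * (z - (s + d * t)^5)"
    if "c + d = f" "c * d = 1" "c^2 + d^2 = -1 - f" "c^3 + d^3 = -1 - f" "c^4 + d^4 = f" "c^5 + d^5 = 2"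
    for z c d f
  proof -
    have prod: "(s + c * t)^5 * (s + d * t)^5 = (s^2 + f * s * t + t^2)^5"
    proof -
      have "(s + c * t) * (s + d * t) = s^2 + (c + d) * s * t + (c * d) * t^2"
        by algebra
      then show ?thesis
        unfolding power_mult_distrib[symmetric] that by simp
    qed
    have "(s + c * t)^5 + (s + d * t)^5 =
        2 * s^5 + (c^5 + d^5) * t^5 + 5 * s^4 * t * (c + d) + 10 * s^3 * t^2 * (c^2 + d^2)
        + 10 * s^2 * t^3 * (c^3 + d^3) + 5 * s * t^4 * (c^4 + d^4)"
      by algebra
    also have "\<dots> = 2 * (s^5+t^5) + 5 * s * t * (s^3+t^3) * f - 10 * s^2 * t^2 * (s+t) * (1+f)"
      unfolding that by algebra
    finally have sum: "(s + c * t)^5 + (s + d * t)^5 =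
        2 * (s^5+t^5) + 5 * s * t * (s^3+t^3) * f - 10 * s^2 * t^2 * (s+t) * (1+f)" .
    have "(z - (s + c * t)^5) * (z - (s + d * t)^5)
        = z^2 - ((s + c * t)^5 + (s + d * t)^5) * z + (s + c * t)^5 * (s + d * t)^5"
      by (simp add: algebra_simps power2_eq_square)
    then show ?thesis unfolding sum prod by simp
  qed
  define f where "f = \<zeta> + \<zeta>^4"
  have f: "f^2 = 1 - f"
    unfolding f_def using cyc by algebra
  have p1: "u\<^sub>0^2 - (2 * (s^5+t^5) + 5 * s * t * (s^3+t^3) * f - 10 * s^2 * t^2 * (s+t) * (1+f)) * u\<^sub>0
      + (s^2 + f * s * t + t^2)^5 = (u\<^sub>0 - (s + \<zeta> * t)^5) * (u\<^sub>0 - (s + \<zeta>^4 * t)^5)"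
    by (rule pair) (use cyc f_def in algebra)+
  have p2: "u\<^sub>0^2 - (2 * (s^5+t^5) + 5 * s * t * (s^3+t^3) * (-1-f) - 10 * s^2 * t^2 * (s+t) * (1+(-1-f))) * u\<^sub>0
      + (s^2 + (-1-f) * s * t + t^2)^5 = (u\<^sub>0 - (s + \<zeta>^2 * t)^5) * (u\<^sub>0 - (s + \<zeta>^3 * t)^5)"
    by (rule pair) (use cyc f_def in algebra)+
  have "u\<^sub>0 = (s + 1 * t)^5 \<or> u\<^sub>0 = (s + \<zeta> * t)^5 \<or> u\<^sub>0 = (s + \<zeta>^4 * t)^5
      \<or> u\<^sub>0 = (s + \<zeta>^2 * t)^5 \<or> u\<^sub>0 = (s + \<zeta>^3 * t)^5"
    using 0 unfolding quintic_factor[OF f] p1 p2 by auto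
  moreover have "(\<zeta>^k)^5 = 1" for k
    using \<zeta>(2) by (metis power_mult power_one mult.commute)
  from this[of 4] this[of 2] this[of 3] have "(1::complex)^5 = 1" "(\<zeta>^4)^5 = 1" "(\<zeta>^2)^5 = 1" "(\<zeta>^3)^5 = 1"
    by simp_all
  ultimately show "\<exists>c. c^5 = 1 \<and> u\<^sub>0 = (s + c * t)^5"
    using \<zeta>(2) by blast
qed

lemma ex_complex_nth_root:
  assumes "n > 0" shows "\<exists>z::complex. z ^ n = w"
proof (cases "w = 0")
  case True
  with assms show ?thesis by (auto intro: exI[of _ 0])
next
  case False
  then have "card {z. z ^ n = w} = n"
    using assms by (rule card_nth_roots)
  with assms have "{z. z ^ n = w} \<noteq> {}"
    by (metis card.empty less_irrefl)
  then show ?thesis by blast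
qed

text \<open>The fifth root of unity is absorbed into \<open>t\<close>, which does not change
  t^5.\<close>

lemma quintic_eq_0_iff:
  fixes u\<^sub>0 u\<^sub>1 u\<^sub>2 :: complex
  shows "quintic u\<^sub>0 u\<^sub>1 u\<^sub>2 = 0 \<longleftrightarrow> (\<exists>s t. u\<^sub>0 = (s + t)^5 \<and> u\<^sub>1 = s^5 \<and> u\<^sub>2 = t^5)"
proof
  assume 0: "quintic u\<^sub>0 u\<^sub>1 u\<^sub>2 = 0"
  obtain s t where st: "s^5 = u\<^sub>1" "t^5 = u\<^sub>2"
    using ex_complex_nth_root[of 5] by fastforce
  then obtain c where "c^5 = 1" "u\<^sub>0 = (s + c * t)^5"
    using 0 quintic_eq_0_iff_fifth_powers by blast
  with st show "\<exists>s t. u\<^sub>0 = (s + t)^5 \<and> u\<^sub>1 = s^5 \<and> u\<^sub>2 = t^5"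
    by (intro exI[of _ s] exI[of _ "c * t"]) (simp add: power_mult_distrib)
qed (auto simp: quintic_param)

section \<open>Singular points of the quintic\<close>

text \<open>One disjunct, carrying two nodes, for each of the ratios s/t, -(s+t)/s and -(s+t)/t that
  can be a primitive fifth root of unity. The relation s0 = s1 + s2 permutes the three cases up to
  signs.\<close>

definition quintic_node :: "'a::idom \<Rightarrow> 'a \<Rightarrow> 'a \<Rightarrow> bool" where
  "quintic_node u\<^sub>0 u\<^sub>1 u\<^sub>2 \<longleftrightarrow>
     u\<^sub>1 = u\<^sub>2 \<and> u\<^sub>0^2 + 11 * u\<^sub>0 * u\<^sub>1 - u\<^sub>1^2 = 0 \<or>
     u\<^sub>0 = - u\<^sub>1 \<and> u\<^sub>2^2 - 11 * u\<^sub>2 * u\<^sub>1 - u\<^sub>1^2 = 0 \<or>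
     u\<^sub>0 = - u\<^sub>2 \<and> u\<^sub>1^2 - 11 * u\<^sub>1 * u\<^sub>2 - u\<^sub>2^2 = 0"

text \<open>With s = \<zeta> t the quotient (s + t)^5 / t^5 is (1 + \<zeta>)^5. It agrees for
  \<zeta> and \<zeta>^-1, so only two values occur, and they satisfy a quadratic equation.\<close>

lemma cyclo5_eq_0:
  fixes s t :: "'a::idom"
  assumes "cyclo5 s t = 0"
  shows "s^5 = t^5" "((s + t)^5)^2 + 11 * (s + t)^5 * t^5 - (t^5)^2 = 0"
proof -
  show "s^5 = t^5"
    using cyclo5_mult[of s t] assms by simp
  show "((s + t)^5)^2 + 11 * (s + t)^5 * t^5 - (t^5)^2 = 0"
    using assms unfolding cyclo5_def by algebra
qed

text \<open>Off the two coordinate lines the factor s^4 t^4 of the z-derivative is nonzero, so one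
  of the cyclotomic factors must vanish.\<close>

lemma quintic_node_if_singular:
  fixes u\<^sub>0 u\<^sub>1 u\<^sub>2 :: complex
  assumes "quintic u\<^sub>0 u\<^sub>1 u\<^sub>2 = 0" "quintic_z u\<^sub>0 u\<^sub>1 u\<^sub>2 = 0" "u\<^sub>1 \<noteq> 0" "u\<^sub>2 \<noteq> 0"
  shows "quintic_node u\<^sub>0 u\<^sub>1 u\<^sub>2"
proof -
  obtain s t where u: "u\<^sub>0 = (s + t)^5" "u\<^sub>1 = s^5" "u\<^sub>2 = t^5"
    using assms(1) quintic_eq_0_iff by blast
  with assms have "cyclo5 s t * cyclo5 (s + t) (- s) * cyclo5 (s + t) (- t) = 0"
    by (auto simp: quintic_z_param)
  then consider "cyclo5 s t = 0" | "cyclo5 (s + t) (- s) = 0" | "cyclo5 (s + t) (- t) = 0"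
    by auto
  then show ?thesis
  proof cases
    case 1
    then show ?thesis
      using cyclo5_eq_0[of s t] by (simp add: u quintic_node_def)
  next
    \<comment> \<open>The arguments \<open>s + t\<close> and \<open>- s\<close> have sum
      \<open>t\<close>, so this is the first case with permuted coordinates; the last case is
      analogous.\<close>
    case 2
    then show ?thesis
      using cyclo5_eq_0[of "s + t" "- s"] by (simp add: u quintic_node_def)
  next
    case 3
    then show ?thesis
      using cyclo5_eq_0[of "s + t" "- t"] by (simp add: u quintic_node_def)
  qed
qed

lemma quintic_singular_if_node:
  fixes u\<^sub>0 u\<^sub>1 u\<^sub>2 :: "'a::idom"
  assumes "quintic_node u\<^sub>0 u\<^sub>1 u\<^sub>2"
  shows "quintic u\<^sub>0 u\<^sub>1 u\<^sub>2 = 0" "quintic_z u\<^sub>0 u\<^sub>1 u\<^sub>2 = 0"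
    "quintic_a u\<^sub>0 u\<^sub>1 u\<^sub>2 = 0" "quintic_a u\<^sub>0 u\<^sub>2 u\<^sub>1 = 0"
proof -
  have 1: "quintic x y y = 0 \<and> quintic_z x y y = 0 \<and> quintic_a x y y = 0"
    if "x^2 + 11 * x * y - y^2 = 0" for x y :: 'a
    unfolding quintic_def quintic_z_def quintic_a_def using that by (intro conjI; algebra)
  have 2: "quintic (- y) y x = 0 \<and> quintic_z (- y) y x = 0 \<and> quintic_a (- y) y x = 0 \<and> quintic_a (- y) x y = 0"
    if "x^2 - 11 * x * y - y^2 = 0" for x y :: 'a
    unfolding quintic_def quintic_z_def quintic_a_def using that by (intro conjI; algebra)
  have z: "quintic_z z a b = quintic_z z b a" for z a b :: 'a
    unfolding quintic_z_def by algebra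
  show "quintic u\<^sub>0 u\<^sub>1 u\<^sub>2 = 0" "quintic_z u\<^sub>0 u\<^sub>1 u\<^sub>2 = 0"
    "quintic_a u\<^sub>0 u\<^sub>1 u\<^sub>2 = 0" "quintic_a u\<^sub>0 u\<^sub>2 u\<^sub>1 = 0"
    using assms 1 2 unfolding quintic_node_def by (metis z quintic_commute)+
qed

section \<open>Homogeneous coordinates\<close>

lemma UNIV_3_from_0: "(UNIV :: 3 set) = {0, 1, 2}"
proof -
  have "(3::3) = 0" by simp
  with UNIV_3 show ?thesis by auto
qed

lemma vec3_eq_iff: "v = w \<longleftrightarrow> v $ 0 = w $ 0 \<and> v $ 1 = w $ 1 \<and> v $ 2 = w $ 2" for v w :: "'a ^ 3"
proof -
  have "(\<forall>i::3. P i) \<longleftrightarrow> P 0 \<and> P 1 \<and> P 2" for P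
    using UNIV_3_from_0 by (metis (full_types) UNIV_I empty_iff insert_iff)
  then show ?thesis by (simp add: vec_eq_iff)
qed

lemma sum_3_from_0: "(\<Sum>i\<in>UNIV. f i) = f 0 + f 1 + f (2::3)"
  unfolding UNIV_3_from_0 by (simp add: add.assoc)

lemma hom_coords_nth [simp]:
  "hom_coords a b c $ 0 = a" "hom_coords a b c $ 1 = b" "hom_coords a b c $ 2 = c"
  by (simp_all add: hom_coords_def)

lemma hom_coords_eq_0_iff: "hom_coords a b c = 0 \<longleftrightarrow> a = 0 \<and> b = 0 \<and> c = 0"
  by (simp add: vec3_eq_iff)

lemma proj_eq_iff:
  assumes "v \<noteq> 0" "w \<noteq> 0"
  shows "proj v = proj w \<longleftrightarrow> (\<exists>c. c \<noteq> 0 \<and> w = c *s v)"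
proof -
  have refl: "proj_equiv u u" if "u \<noteq> 0" for u
    using that unfolding proj_equiv_def by (metis vector_smult_lid zero_neq_one)
  have "proj_equiv v w \<longleftrightarrow> proj v = proj w"
    using Quotient3_rel[OF Quotient3_cp2, of v w] refl assms by blast
  then show ?thesis using assms by (simp add: proj_equiv_def)
qed

lemma proj_smult: "c \<noteq> 0 \<Longrightarrow> v \<noteq> 0 \<Longrightarrow> proj (c *s v) = proj v"
  by (subst eq_commute, subst proj_eq_iff) auto

lemma cp2_cases: obtains v where "v \<noteq> 0" "z = proj v"
proof -
  have "proj_equiv (rep_cp2 z) (rep_cp2 z)"
    by (rule Quotient3_rep_reflp[OF Quotient3_cp2])
  then have "rep_cp2 z \<noteq> 0"
    by (simp add: proj_equiv_def)
  moreover have "z = proj (rep_cp2 z)"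
    by (simp add: Quotient3_abs_rep[OF Quotient3_cp2])
  ultimately show thesis using that by blast
qed

lemma eval_poly_smult:
  assumes "homogeneous d p"
  shows "eval_poly p (c *s v) = c ^ d * eval_poly p v"
proof -
  have "(\<Prod>i\<in>UNIV. (c *s v) $ i ^ Poly_Mapping.lookup m i) =
      c ^ d * (\<Prod>i\<in>UNIV. v $ i ^ Poly_Mapping.lookup m i)" if "m \<in> Poly_Mapping.keys p" for m
    using assms that unfolding homogeneous_def
    by (simp add: power_mult_distrib prod.distrib flip: power_sum)
  then show ?thesis
    by (simp add: eval_poly_def sum_distrib_left mult.left_commute)
qed

lemma proj_in_curve_iff:
  assumes "homogeneous d p" "v \<noteq> 0"
  shows "proj v \<in> curve p \<longleftrightarrow> eval_poly p v = 0"
proof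
  assume "proj v \<in> curve p"
  then obtain w where w: "w \<noteq> 0" "proj v = proj w" "eval_poly p w = 0"
    by (auto simp: curve_def)
  then obtain c where "v = c *s w"
    using proj_eq_iff[of w v] assms(2) by auto
  then show "eval_poly p v = 0"
    using w eval_poly_smult[OF assms(1)] by simp
qed (use assms in \<open>auto simp: curve_def\<close>)

lemma closed_curve:
  assumes "homogeneous d p"
  shows "closed (curve p)"
proof -
  have "{v. v \<noteq> 0 \<and> proj v \<in> - curve p} = - {0} \<inter> eval_poly p -` (- {0})"
    using proj_in_curve_iff[OF assms] by auto
  moreover have "open (eval_poly p -` (- {0}))"
    by (intro open_vimage continuous_on_eval_poly open_Compl) auto
  ultimately show ?thesis
    unfolding closed_def open_cp2_def by (simp add: open_Int open_Compl)
qed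

section \<open>The sextic and its dual curve\<close>

lemma homogeneous_p_sextic: "homogeneous 6 p_sextic"
  unfolding p_sextic_def
  using homogeneous_power[OF homogeneous_Var, of 6] by (intro homogeneous_diff) auto

lemma homogeneous_q_dual: "homogeneous 30 q_dual"
proof -
  have var: "homogeneous n (Var i ^ n)" for i n
    using homogeneous_power[OF homogeneous_Var, of n i] by simp
  have num: "homogeneous d p \<Longrightarrow> homogeneous d (numeral k * p)" for d p k
    using homogeneous_mult[OF homogeneous_numeral] by fastforce
  have mon2: "homogeneous n (numeral k * Var i ^ a * Var j ^ b)" if "a + b = n" for a b n i j k
    using homogeneous_mult[OF num[OF var] var] that by metis
  have mon3: "homogeneous n (numeral k * Var i ^ a * Var j ^ b * Var l ^ c)" if "a + b + c = n" for a b c n i j k l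
    using homogeneous_mult[OF homogeneous_mult[OF num[OF var] var] var] that by metis
  show ?thesis
    unfolding q_dual_def Let_def
    by (intro homogeneous_diff homogeneous_add var mon3 mon2) simp_all
qed

lemma eval_p_sextic: "eval_poly p_sextic v = (v $ 0)^6 - (v $ 1)^6 - (v $ 2)^6"
  by (simp add: p_sextic_def eval_poly_simps)

lemma eval_hom_q_dual:
  fixes h :: "real \<Rightarrow> 'r::idom"
  assumes "coeff_hom h"
  shows "eval_hom h v q_dual = quintic ((v 0)^6) ((v 1)^6) ((v 2)^6)"
proof -
  interpret coeff_hom h by fact
  have "quintic (x^6) (y^6) (z^6) = x^30 - 5 * y^6 * x^24 - 5 * z^6 * x^24
     + 10 * y^12 * x^18 + 10 * z^12 * x^18
     - 605 * y^6 * z^6 * x^18 - 10 * y^18 * x^12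
     - 10 * z^18 * x^12 - 1905 * y^6 * z^12 * x^12 - 1905 * y^12 * z^6 * x^12
     + 5 * y^24 * x^6 + 5 * z^24 * x^6 - 605 * y^6 * z^18 * x^6
     + 1905 * y^12 * z^12 * x^6 - 605 * y^18 * z^6 * x^6 - y^30 - z^30
     - 5 * y^6 * z^24 - 10 * y^12 * z^18 - 10 * y^18 * z^12 - 5 * y^24 * z^6" for x y z :: 'r
    unfolding quintic_def by algebra
  then show ?thesis
    by (simp add: q_dual_def Let_def eval_hom_simps)
qed

lemma eval_q_dual: "eval_poly q_dual v = quintic ((v $ 0)^6) ((v $ 1)^6) ((v $ 2)^6)"
  unfolding eval_poly_eq_eval_hom
  by (rule eval_hom_q_dual) (rule of_real_complex.coeff_hom_axioms)

lemma gradient_p_sextic: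
  "gradient p_sextic v = 6 *s hom_coords ((v $ 0)^5) (- ((v $ 1)^5)) (- ((v $ 2)^5))"
proof -
  have "gradient p_sextic v $ 0 = 6 * (v $ 0)^5"
    by (rule gradient_nth_eqI) (auto simp: eval_p_sextic intro!: derivative_eq_intros)
  moreover have "gradient p_sextic v $ 1 = - 6 * (v $ 1)^5"
    by (rule gradient_nth_eqI) (auto simp: eval_p_sextic intro!: derivative_eq_intros)
  moreover have "gradient p_sextic v $ 2 = - 6 * (v $ 2)^5"
    by (rule gradient_nth_eqI) (auto simp: eval_p_sextic intro!: derivative_eq_intros)
  ultimately show ?thesis
    by (simp add: vec3_eq_iff)
qed

lemma DERIV_quintic_z:
  "((\<lambda>z. quintic z a b) has_field_derivative quintic_z z a b) (at z)" for z :: complex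
  unfolding quintic_def quintic_z_def
  by (rule derivative_eq_intros refl | simp add: algebra_simps)+

lemma DERIV_quintic_a:
  "((\<lambda>a. quintic z a b) has_field_derivative quintic_a z a b) (at a)" for z :: complex
proof -
  \<comment> \<open>Regrouped by powers of \<open>a\<close>, so that the derivative can be taken
    term by term.\<close>
  have eq: "quintic z a b = z^5 - 5 * b * z^4 + 10 * b^2 * z^3 - 10 * b^3 * z^2 + 5 * b^4 * z - b^5
      + (- 5 * z^4 - 605 * b * z^3 - 1905 * b^2 * z^2 - 605 * b^3 * z - 5 * b^4) * a
      + (10 * z^3 - 1905 * b * z^2 + 1905 * b^2 * z - 10 * b^3) * a^2
      + (- 10 * z^2 - 605 * b * z - 10 * b^2) * a^3 + (5 * z - 5 * b) * a^4 - a^5" for a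
    unfolding quintic_def by algebra
  have eq': "quintic_a z a b =
      (- 5 * z^4 - 605 * b * z^3 - 1905 * b^2 * z^2 - 605 * b^3 * z - 5 * b^4)
      + 2 * (10 * z^3 - 1905 * b * z^2 + 1905 * b^2 * z - 10 * b^3) * a
      + 3 * (- 10 * z^2 - 605 * b * z - 10 * b^2) * a^2 + 4 * (5 * z - 5 * b) * a^3 - 5 * a^4"
    unfolding quintic_a_def by algebra
  show ?thesis
    unfolding eq eq' by (auto intro!: derivative_eq_intros simp: algebra_simps)
qed

lemma gradient_q_dual:
  fixes v :: "complex ^ 3"
  defines "u \<equiv> \<lambda>i. (v $ i)^6"
  shows "gradient q_dual v = hom_coords (6 * (v $ 0)^5 * quintic_z (u 0) (u 1) (u 2))
    (6 * (v $ 1)^5 * quintic_a (u 0) (u 1) (u 2)) (6 * (v $ 2)^5 * quintic_a (u 0) (u 2) (u 1))"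
proof -
  have chain: "((\<lambda>z. f (z^6)) has_field_derivative 6 * x^5 * D) (at x)"
    if "(f has_field_derivative D) (at (x^6))" for f D and x :: complex
    by (rule DERIV_cong[OF DERIV_chain2[where g = "\<lambda>z. z^6", OF that]]) (auto intro!: derivative_eq_intros)
  have "gradient q_dual v $ 0 = 6 * (v $ 0)^5 * quintic_z (u 0) (u 1) (u 2)"
    unfolding u_def by (rule gradient_nth_eqI) (simp add: eval_q_dual chain[OF DERIV_quintic_z])
  moreover have "gradient q_dual v $ 1 = 6 * (v $ 1)^5 * quintic_a (u 0) (u 1) (u 2)"
    unfolding u_def by (rule gradient_nth_eqI) (simp add: eval_q_dual chain[OF DERIV_quintic_a])
  moreover have "gradient q_dual v $ 2 = 6 * (v $ 2)^5 * quintic_a (u 0) (u 2) (u 1)"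
  proof (rule gradient_nth_eqI)
    have "eval_poly q_dual (\<chi> j. if j = 2 then z else v $ j) = quintic (u 0) (z^6) (u 1)" for z
      by (simp add: eval_q_dual u_def) (rule quintic_commute)
    then show "((\<lambda>z. eval_poly q_dual (\<chi> j. if j = 2 then z else v $ j)) has_field_derivative
        6 * (v $ 2)^5 * quintic_a (u 0) (u 2) (u 1)) (at (v $ 2))"
      by (simp add: u_def chain[OF DERIV_quintic_a])
  qed
  ultimately show ?thesis
    by (simp add: vec3_eq_iff)
qed

text \<open>The sextic is smooth: the fifth powers vanish together only at the zero vector, so
  regularity imposes no condition. The factor 6 of the gradient disappears projectively.\<close>

lemma tangent_at_sextic_iff:
  "tangent_at p_sextic x y \<longleftrightarrow> (\<exists>v. v \<noteq> 0 \<and> x = proj v \<and> (v $ 0)^6 = (v $ 1)^6 + (v $ 2)^6 \<and>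
     y = proj (hom_coords ((v $ 0)^5) (- ((v $ 1)^5)) (- ((v $ 2)^5))))"
proof -
  have "gradient p_sextic v \<noteq> 0 \<and>
      proj (gradient p_sextic v) = proj (hom_coords ((v $ 0)^5) (- ((v $ 1)^5)) (- ((v $ 2)^5)))" if "v \<noteq> 0" for v
  proof -
    have "hom_coords ((v $ 0)^5) (- ((v $ 1)^5)) (- ((v $ 2)^5)) \<noteq> 0"
      using that by (auto simp: hom_coords_eq_0_iff vec3_eq_iff)
    then show ?thesis
      by (simp add: gradient_p_sextic proj_smult)
  qed
  moreover have "eval_poly p_sextic v = 0 \<longleftrightarrow> (v $ 0)^6 = (v $ 1)^6 + (v $ 2)^6" for v
    by (simp add: eval_p_sextic diff_eq_eq add.commute)
  ultimately show ?thesis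
    unfolding tangent_at_def by (intro ex_cong1) auto
qed

text \<open>As 5 and 6 are coprime, x = s / w inverts the parametrisation (x^5, x^6) of the cusp.
  This recovers the point of contact from a tangent.\<close>

lemma power6_eq_power5_parametrization:
  assumes "w^6 = s^5"
  shows "\<exists>x::'a::field. x^5 = w \<and> x^6 = s"
proof (cases "w = 0")
  case True
  with assms show ?thesis by (intro exI[of _ 0]) simp
next
  case False
  then have "s \<noteq> 0" using assms by auto
  have "(s / w)^5 = w"
    using False by (simp add: power_divide flip: assms) (simp add: divide_simps eval_nat_numeral)
  moreover have "(s / w)^6 = s"
  proof -
    have "s^6 = s * w^6" unfolding assms by (simp add: eval_nat_numeral)
    with False show ?thesis by (simp add: power_divide)
  qed
  ultimately show ?thesis by blast
qed

lemma sextic_tangents_eq_curve: "{y. \<exists>x. tangent_at p_sextic x y} = curve q_dual"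
proof (intro set_eqI iffI)
  fix y assume "y \<in> {y. \<exists>x. tangent_at p_sextic x y}"
  then obtain v :: "complex ^ 3" where v: "v \<noteq> 0" "(v $ 0)^6 = (v $ 1)^6 + (v $ 2)^6"
    and y: "y = proj (hom_coords ((v $ 0)^5) (- ((v $ 1)^5)) (- ((v $ 2)^5)))"
    unfolding tangent_at_sextic_iff by blast
  have "eval_poly q_dual (hom_coords ((v $ 0)^5) (- ((v $ 1)^5)) (- ((v $ 2)^5)))
      = quintic (((v $ 0)^6)^5) (((v $ 1)^6)^5) (((v $ 2)^6)^5)"
    by (simp add: eval_q_dual flip: power_mult)
  also have "\<dots> = 0"
    unfolding v(2) by (rule quintic_param)
  finally show "y \<in> curve q_dual"
    using v(1) y by (auto simp: curve_def hom_coords_eq_0_iff vec3_eq_iff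
        intro!: exI[of _ "hom_coords ((v $ 0)^5) (- ((v $ 1)^5)) (- ((v $ 2)^5))"])
next
  fix y assume "y \<in> curve q_dual"
  then obtain w where w: "w \<noteq> 0" "y = proj w" "quintic ((w $ 0)^6) ((w $ 1)^6) ((w $ 2)^6) = 0"
    by (auto simp: curve_def eval_q_dual)
  then obtain s t where st: "(w $ 0)^6 = (s + t)^5" "(w $ 1)^6 = s^5" "(w $ 2)^6 = t^5"
    unfolding quintic_eq_0_iff by blast
  obtain a where a: "a^5 = w $ 0" "a^6 = s + t"
    using power6_eq_power5_parametrization[OF st(1)] by blast
  obtain b where b: "b^5 = w $ 1" "b^6 = s"
    using power6_eq_power5_parametrization[OF st(2)] by blast
  obtain c where c: "c^5 = w $ 2" "c^6 = t"
    using power6_eq_power5_parametrization[OF st(3)] by blast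
  \<comment> \<open>The signs cancel those of the gradient and disappear in the sixth
    powers.\<close>
  let ?v = "hom_coords a (- b) (- c)"
  have "w = hom_coords ((?v $ 0)^5) (- ((?v $ 1)^5)) (- ((?v $ 2)^5))"
    by (simp add: vec3_eq_iff a b c)
  moreover have "?v \<noteq> 0"
    using w(1) a b c by (auto simp: hom_coords_eq_0_iff vec3_eq_iff)
  moreover have "(?v $ 0)^6 = (?v $ 1)^6 + (?v $ 2)^6"
    by (simp add: a b c)
  ultimately have "tangent_at p_sextic (proj ?v) y"
    unfolding tangent_at_sextic_iff w(2) by blast
  then show "y \<in> {y. \<exists>x. tangent_at p_sextic x y}"
    by blast
qed

text \<open>Every point of the sextic has a tangent, and these tangents already fill a closed curve,
  so the closure adds no points.\<close>

lemma dual_curve_sextic: "dual_curve p_sextic = curve q_dual"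
  unfolding dual_curve_def sextic_tangents_eq_curve
  using closed_curve[OF homogeneous_q_dual] by (rule closure_closed)

section \<open>Singular points of the dual curve\<close>

text \<open>The last three disjuncts are contact points with a coordinate line: there the quintic
  restricts, up to sign, to the fifth power of a linear form in the other two coordinates, while the
  derivative in the vanishing coordinate \<open>y\<close> carries a factor y^5.\<close>

definition dual_singular :: "'a::idom \<Rightarrow> 'a \<Rightarrow> 'a \<Rightarrow> bool" where
  "dual_singular u\<^sub>0 u\<^sub>1 u\<^sub>2 \<longleftrightarrow> quintic_node u\<^sub>0 u\<^sub>1 u\<^sub>2 \<or>
     u\<^sub>0 = 0 \<and> u\<^sub>1 = - u\<^sub>2 \<or> u\<^sub>1 = 0 \<and> u\<^sub>0 = u\<^sub>2 \<or> u\<^sub>2 = 0 \<and> u\<^sub>0 = u\<^sub>1"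

lemma dual_singular_smult:
  fixes k :: "'a::field"
  assumes "k \<noteq> 0"
  shows "dual_singular (k * u\<^sub>0) (k * u\<^sub>1) (k * u\<^sub>2) \<longleftrightarrow> dual_singular u\<^sub>0 u\<^sub>1 u\<^sub>2"
proof -
  have "(k * x)^2 + 11 * (k * x) * (k * y) - (k * y)^2 = k^2 * (x^2 + 11 * x * y - y^2)"
    "(k * x)^2 - 11 * (k * x) * (k * y) - (k * y)^2 = k^2 * (x^2 - 11 * x * y - y^2)" for x y
    by - algebra+
  moreover have "k * x = - (k * y) \<longleftrightarrow> x = - y" for x y
    using assms by (metis mult_cancel_left mult_minus_right)
  ultimately show ?thesis
    using assms by (simp add: dual_singular_def quintic_node_def)
qed

lemma gradient_q_dual_eq_0_iff:
  "eval_poly q_dual v = 0 \<and> gradient q_dual v = 0 \<longleftrightarrow>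
     dual_singular ((v $ 0)^6) ((v $ 1)^6) ((v $ 2)^6)"
proof -
  define a b c where "a = v $ 0" and "b = v $ 1" and "c = v $ 2"
  have q0: "quintic 0 (b^6) (c^6) = - ((b^6 + c^6)^5)"
    and q1: "quintic (a^6) 0 (c^6) = (a^6 - c^6)^5"
    and q2: "quintic (a^6) (b^6) 0 = (a^6 - b^6)^5"
    unfolding quintic_def by (simp, (simp, algebra)+)
  \<comment> \<open>At the contact points the remaining two partial derivatives of the quintic
    vanish as well.\<close>
  have z: "quintic_z x 0 x = 0 \<and> quintic_z x x 0 = 0 \<and> quintic_a x x 0 = 0 \<and> quintic_a 0 (- x) x = 0 \<and> quintic_a 0 x (- x) = 0"
    for x :: complex
    unfolding quintic_z_def quintic_a_def by (intro conjI; simp; algebra)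
  have "quintic (a^6) (b^6) (c^6) = 0 \<and> (a = 0 \<or> quintic_z (a^6) (b^6) (c^6) = 0) \<and>
      (b = 0 \<or> quintic_a (a^6) (b^6) (c^6) = 0) \<and> (c = 0 \<or> quintic_a (a^6) (c^6) (b^6) = 0)
      \<longleftrightarrow> dual_singular (a^6) (b^6) (c^6)" (is "?lhs \<longleftrightarrow> _")
  proof
    assume lhs: ?lhs
    consider "a = 0" | "b = 0" | "c = 0" | "a \<noteq> 0" "b \<noteq> 0" "c \<noteq> 0" by blast
    then show "dual_singular (a^6) (b^6) (c^6)"
    proof cases
      case 1
      with lhs q0 show ?thesis by (simp add: dual_singular_def eq_neg_iff_add_eq_0)
    next
      case 2
      with lhs q1 show ?thesis by (simp add: dual_singular_def)
    next
      case 3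
      with lhs q2 show ?thesis by (simp add: dual_singular_def)
    next
      case 4
      with lhs show ?thesis
        using quintic_node_if_singular[of "a^6" "b^6" "c^6"] by (simp add: dual_singular_def)
    qed
  next
    assume "dual_singular (a^6) (b^6) (c^6)"
    then consider "quintic_node (a^6) (b^6) (c^6)" | "a = 0" "b^6 = - (c^6)"
      | "b = 0" "a^6 = c^6" | "c = 0" "a^6 = b^6"
      by (auto simp: dual_singular_def)
    then show ?lhs
    proof cases
      case 1
      then show ?thesis using quintic_singular_if_node by blast
    next
      case 2
      then show ?thesis using q0 z[of "c^6"] by simp
    next
      case 3
      then show ?thesis using q1 z[of "c^6"] by simp
    next
      case 4
      then show ?thesis using q2 z[of "b^6"] by simp
    qed
  qed
  then show ?thesis
    by (simp add: gradient_q_dual eval_q_dual hom_coords_eq_0_iff a_def b_def c_def)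
qed

lemma proj_in_singular_points_iff:
  assumes "v \<noteq> 0"
  shows "proj v \<in> singular_points q_dual \<longleftrightarrow> dual_singular ((v $ 0)^6) ((v $ 1)^6) ((v $ 2)^6)"
proof -
  have "proj v \<in> singular_points q_dual \<longleftrightarrow>
      (\<exists>w. w \<noteq> 0 \<and> proj v = proj w \<and> dual_singular ((w $ 0)^6) ((w $ 1)^6) ((w $ 2)^6))"
    unfolding singular_points_def gradient_q_dual_eq_0_iff by simp
  also have "\<dots> \<longleftrightarrow> dual_singular ((v $ 0)^6) ((v $ 1)^6) ((v $ 2)^6)"
  proof
    assume "\<exists>w. w \<noteq> 0 \<and> proj v = proj w \<and> dual_singular ((w $ 0)^6) ((w $ 1)^6) ((w $ 2)^6)"
    then obtain w where w: "w \<noteq> 0" "proj v = proj w" "dual_singular ((w $ 0)^6) ((w $ 1)^6) ((w $ 2)^6)"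
      by blast
    then obtain c where "c \<noteq> 0" "w = c *s v"
      using proj_eq_iff assms by blast
    with w(3) show "dual_singular ((v $ 0)^6) ((v $ 1)^6) ((v $ 2)^6)"
      by (simp add: power_mult_distrib dual_singular_smult)
  qed (use assms in blast)
  finally show ?thesis .
qed

section \<open>Affine singular points and their number\<close>

lemma affine_point_eq_iff: "affine_point x = affine_point y \<longleftrightarrow> x = y"
proof
  assume "affine_point x = affine_point y"
  then obtain c where "hom_coords 1 (y $ 1) (y $ 2) = c *s hom_coords 1 (x $ 1) (x $ 2)"
    unfolding affine_point_def by (subst (asm) proj_eq_iff) (auto simp: hom_coords_eq_0_iff)
  then show "x = y"
    by (auto simp: vec3_eq_iff vec_eq_iff forall_2)
qed simp

lemma real_affine_point_eq:
  "real_affine_point x = proj (hom_coords 1 (of_real (x $ 1)) (of_real (x $ 2)))"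
  by (simp add: real_affine_point_def affine_point_def)

lemma real_affine_point_eq_iff: "real_affine_point x = real_affine_point y \<longleftrightarrow> x = y"
  by (simp add: real_affine_point_def affine_point_eq_iff vec_eq_iff)

text \<open>The roots of \<open>v\<^sup>2 - 11 v - 1\<close>.\<close>

definition node_coord :: real where
  "node_coord = (11 + 5 * sqrt 5) / 2"

definition node_coord' :: real where
  "node_coord' = (11 - 5 * sqrt 5) / 2"

lemma node_coord_bounds: "11 < node_coord" "node_coord < 11.1" "- 0.1 < node_coord'" "node_coord' < 0"
proof -
  have "2.236 < sqrt 5"
    by (rule real_less_rsqrt) (simp add: power2_eq_square)
  moreover have "sqrt 5 < 2.23607"
    by (rule real_less_lsqrt) (simp_all add: power2_eq_square)
  ultimately show "11 < node_coord" "node_coord < 11.1" "- 0.1 < node_coord'" "node_coord' < 0"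
    unfolding node_coord_def node_coord'_def by simp_all
qed

lemma node_coord_roots:
  fixes x :: "'a::{real_algebra_1, field}"
  shows "1 + 11 * x - x^2 = 0 \<longleftrightarrow> x = of_real node_coord \<or> x = of_real node_coord'"
    and "x^2 + 11 * x - 1 = 0 \<longleftrightarrow> x = - of_real node_coord \<or> x = - of_real node_coord'"
proof -
  have "node_coord + node_coord' = 11" "node_coord * node_coord' = - 1"
    unfolding node_coord_def node_coord'_def by (simp_all add: field_simps)
  then have "of_real node_coord + of_real node_coord' = (11::'a)" "of_real node_coord * of_real node_coord' = (- 1::'a)"
    by (simp_all flip: of_real_add of_real_mult)
  moreover have "- ((x - g) * (x - h)) = - (g * h) + (g + h) * x - x^2"
    "(x - (- g)) * (x - (- h)) = x^2 + (g + h) * x + g * h" for g h :: 'a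
    by (simp_all add: algebra_simps power2_eq_square)
  ultimately have "1 + 11 * x - x^2 = - ((x - of_real node_coord) * (x - of_real node_coord'))"
    "x^2 + 11 * x - 1 = (x - (- of_real node_coord)) * (x - (- of_real node_coord'))"
    by simp_all
  then show "1 + 11 * x - x^2 = 0 \<longleftrightarrow> x = of_real node_coord \<or> x = of_real node_coord'"
    "x^2 + 11 * x - 1 = 0 \<longleftrightarrow> x = - of_real node_coord \<or> x = - of_real node_coord'"
    by (simp_all only: neg_equal_0_iff_equal mult_eq_0_iff right_minus_eq)
qed

text \<open>The nodes in the chart u0 = 1. Only the first pair has nonnegative entries, so it alone
  consists of sixth powers of real numbers.\<close>

definition node_pairs :: "(real \<times> real) set" where
  "node_pairs = {(node_coord, node_coord), (node_coord', node_coord'), (- 1, - node_coord),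
     (- 1, - node_coord'), (- node_coord, - 1), (- node_coord', - 1)}"

lemma card_node_pairs: "card node_pairs = 6"
  using node_coord_bounds by (simp add: node_pairs_def)

lemma dual_singular_affine_iff:
  fixes a b :: "'a::{real_algebra_1, field}"
  shows "dual_singular 1 a b \<longleftrightarrow> (a, b) \<in> map_prod of_real of_real ` (node_pairs \<union> {(0, 1), (1, 0)})"
proof -
  have neg: "1 = - a \<longleftrightarrow> a = - 1" "1 = - b \<longleftrightarrow> b = - 1"
    by (metis minus_minus)+
  have "quintic_node 1 a b \<longleftrightarrow> a = b \<and> 1 + 11 * a - a^2 = 0 \<or> a = - 1 \<and> b^2 + 11 * b - 1 = 0 \<or>
      b = - 1 \<and> a^2 + 11 * a - 1 = 0"
    unfolding quintic_node_def neg by auto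
  then show ?thesis
    unfolding dual_singular_def node_coord_roots node_pairs_def by auto
qed

lemma affine_point_in_singular_points_iff:
  "affine_point x \<in> singular_points q_dual \<longleftrightarrow> dual_singular 1 ((x $ 1)^6) ((x $ 2)^6)"
  unfolding affine_point_def by (subst proj_in_singular_points_iff) (auto simp: hom_coords_eq_0_iff)

lemma card_affine_singular_points: "card (singular_points q_dual \<inter> range affine_point) = 228"
proof -
  define fib :: "real \<times> real \<Rightarrow> (complex ^ 2) set" where
    "fib = (\<lambda>(a, b). {x. (x $ 1)^6 = of_real a \<and> (x $ 2)^6 = of_real b})"
  define r where "r = (\<lambda>a::real. {z::complex. z^6 = of_real a})"
  have r_0: "r 0 = {0}" and r: "a \<noteq> 0 \<Longrightarrow> card (r a) = 6" for a
    by (auto simp: r_def card_nth_roots)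
  have fin_r: "finite (r a)" for a
    unfolding r_def by (rule finite_nth_roots) simp
  have fib_eq: "fib (a, b) = (\<lambda>(x, y). vector [x, y]) ` (r a \<times> r b)" for a b
  proof (intro set_eqI iffI)
    fix x assume "x \<in> fib (a, b)"
    then have "(x $ 1, x $ 2) \<in> r a \<times> r b" "x = (\<lambda>(x, y). vector [x, y]) (x $ 1, x $ 2)"
      by (simp_all add: fib_def r_def vec_eq_iff forall_2)
    then show "x \<in> (\<lambda>(x, y). vector [x, y]) ` (r a \<times> r b)" by blast
  qed (auto simp: fib_def r_def)
  have inj: "inj (\<lambda>(x, y). vector [x, y] :: complex ^ 2)"
    by (auto simp: inj_def vec_eq_iff forall_2)
  have card_fib: "card (fib (a, b)) = card (r a) * card (r b)" for a b
    unfolding fib_eq using inj by (simp add: card_image inj_on_subset card_cartesian_product)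
  have fin_fib: "finite (fib (a, b))" for a b
    unfolding fib_eq using fin_r by simp
  have nz: "a \<noteq> 0" "b \<noteq> 0" if "(a, b) \<in> node_pairs" for a b
    using that node_coord_bounds by (auto simp: node_pairs_def)
  have "singular_points q_dual \<inter> range affine_point =
      affine_point ` {x. dual_singular 1 ((x $ 1)^6) ((x $ 2)^6)}"
    using affine_point_in_singular_points_iff by auto
  also have "{x. dual_singular 1 ((x $ 1)^6) ((x $ 2)^6)} = (\<Union>p\<in>node_pairs \<union> {(0, 1), (1, 0)}. fib p)"
    unfolding dual_singular_affine_iff by (force simp: fib_def)
  finally have "card (singular_points q_dual \<inter> range affine_point)
      = card (\<Union>p\<in>node_pairs \<union> {(0, 1), (1, 0)}. fib p)"
    by (simp add: card_image inj_on_def affine_point_eq_iff)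
  also have "\<dots> = (\<Sum>p\<in>node_pairs \<union> {(0, 1), (1, 0)}. card (fib p))"
  proof (rule card_UN_disjoint)
    have "fib p \<inter> fib q = {}" if "p \<noteq> q" for p q
      using that unfolding fib_def by (auto simp: split_beta prod_eq_iff)
    then show "\<forall>p\<in>node_pairs \<union> {(0, 1), (1, 0)}. \<forall>q\<in>node_pairs \<union> {(0, 1), (1, 0)}.
        p \<noteq> q \<longrightarrow> fib p \<inter> fib q = {}" by blast
  qed (use fin_fib in \<open>auto simp: node_pairs_def\<close>)
  also have "\<dots> = (\<Sum>p\<in>node_pairs. card (fib p)) + (\<Sum>p\<in>{(0, 1), (1, 0)}. card (fib p))"
  proof (rule sum.union_disjoint)
    show "node_pairs \<inter> {(0, 1), (1, 0)} = {}" using nz by blast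
  qed (simp_all add: node_pairs_def)
  also have "(\<Sum>p\<in>node_pairs. card (fib p)) = (\<Sum>p\<in>node_pairs. 36)"
  proof (rule sum.cong)
    fix p assume "p \<in> node_pairs"
    then show "card (fib p) = 36"
      using nz by (cases p) (simp add: card_fib r)
  qed simp
  also have "(\<Sum>p\<in>{(0, 1), (1, 0)}. card (fib p)) = 12"
    by (simp add: card_fib r r_0)
  finally show ?thesis
    by (simp add: card_node_pairs)
qed

lemma omega_power6: "\<omega>^6 = node_coord" and omega_pos: "\<omega> > 0"
  using node_coord_bounds by (simp_all add: \<omega>_def flip: node_coord_def)

text \<open>The bounds 11 and 11.1 for \<omega>^6 suffice, since 1.485^6 < 11 and 11.1 <
  1.495^6.\<close>

lemma omega_approx: "\<bar>\<omega> - 1.49\<bar> < 0.005"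
proof -
  have "1.485 < \<omega>"
    by (rule power_less_imp_less_base[of _ 6])
      (use omega_power6 omega_pos node_coord_bounds in \<open>simp_all add: power_divide\<close>)
  moreover have "\<omega> < 1.495"
    by (rule power_less_imp_less_base[of _ 6])
      (use omega_power6 omega_pos node_coord_bounds in \<open>simp_all add: power_divide\<close>)
  ultimately show ?thesis by (simp add: abs_if)
qed

section \<open>Real singular points\<close>

lemma power6_eq_iff: "x^6 = y^6 \<longleftrightarrow> x = y \<or> x = - y" for x y :: real
proof -
  have "x^6 = y^6 \<longleftrightarrow> \<bar>x\<bar>^6 = \<bar>y\<bar>^6" by simp
  also have "\<dots> \<longleftrightarrow> \<bar>x\<bar> = \<bar>y\<bar>" by (rule power_eq_iff_eq_base) auto
  finally show ?thesis by (auto simp: abs_if split: if_splits)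
qed

lemma mem_axis_diagonal_points_iff:
  "x \<in> axis_points \<longleftrightarrow> (x $ 1)^6 = 1 \<and> x $ 2 = 0 \<or> x $ 1 = 0 \<and> (x $ 2)^6 = 1"
  "x \<in> diagonal_points \<longleftrightarrow> (x $ 1)^6 = node_coord \<and> (x $ 2)^6 = node_coord"
proof -
  have "(x $ 1)^6 = 1 \<longleftrightarrow> x $ 1 = 1 \<or> x $ 1 = - 1" "(x $ 2)^6 = 1 \<longleftrightarrow> x $ 2 = 1 \<or> x $ 2 = - 1"
    using power6_eq_iff[of _ 1] by simp_all
  then show "x \<in> axis_points \<longleftrightarrow> (x $ 1)^6 = 1 \<and> x $ 2 = 0 \<or> x $ 1 = 0 \<and> (x $ 2)^6 = 1"
    by (auto simp: axis_points_def vec_eq_iff forall_2)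
  show "x \<in> diagonal_points \<longleftrightarrow> (x $ 1)^6 = node_coord \<and> (x $ 2)^6 = node_coord"
    unfolding omega_power6[symmetric] power6_eq_iff
    by (auto simp: diagonal_points_def vec_eq_iff forall_2)
qed

lemma real_affine_point_in_singular_points_iff:
  "real_affine_point x \<in> singular_points q_dual \<longleftrightarrow> x \<in> axis_points \<union> diagonal_points"
proof -
  have inj: "inj (map_prod of_real of_real :: real \<times> real \<Rightarrow> complex \<times> complex)"
    by (auto simp: inj_def)
  have "real_affine_point x \<in> singular_points q_dual \<longleftrightarrow>
      ((x $ 1)^6, (x $ 2)^6) \<in> node_pairs \<union> {(0, 1), (1, 0)}"
  proof -
    have "(((\<chi> i. complex_of_real (x $ i)) $ 1)^6, ((\<chi> i. complex_of_real (x $ i)) $ 2)^6)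
        = map_prod of_real of_real ((x $ 1)^6, (x $ 2)^6)" by simp
    then show ?thesis
      unfolding real_affine_point_def affine_point_in_singular_points_iff dual_singular_affine_iff
      by (simp only: inj_image_mem_iff[OF inj])
  qed
  also have "\<dots> \<longleftrightarrow> x \<in> axis_points \<union> diagonal_points"
  proof -
    have "(a, b) \<in> node_pairs \<longleftrightarrow> a = node_coord \<and> b = node_coord" if "a \<ge> 0" "b \<ge> 0" for a b
      using node_coord_bounds that unfolding node_pairs_def by auto
    from this[of "(x $ 1)^6" "(x $ 2)^6"] show ?thesis
      by (auto simp: mem_axis_diagonal_points_iff)
  qed
  finally show ?thesis .
qed

lemma is_real_real_affine_point: "is_real (real_affine_point x)"
  unfolding is_real_def
proof (intro exI conjI)
  let ?v = "(\<chi> i. if i = 0 then 1 else if i = 1 then x $ 1 else x $ 2) :: real ^ 3"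
  show "?v \<noteq> 0" by (auto simp: vec3_eq_iff)
  have "hom_coords 1 (of_real (x $ 1)) (of_real (x $ 2)) = (\<chi> i. of_real (?v $ i))"
    by (simp add: vec3_eq_iff)
  then show "real_affine_point x = proj (\<chi> i. of_real (?v $ i))"
    by (simp add: real_affine_point_eq)
qed

lemma real_singular_points:
  "{z \<in> singular_points q_dual. is_real z} = real_affine_point ` (axis_points \<union> diagonal_points)"
proof (intro set_eqI iffI)
  fix z assume "z \<in> {z \<in> singular_points q_dual. is_real z}"
  then have sing: "z \<in> singular_points q_dual" and "is_real z" by auto
  then obtain v :: "real ^ 3" where v: "v \<noteq> 0" "z = proj (\<chi> i. of_real (v $ i))"
    unfolding is_real_def by blast
  have v': "((\<chi> i. of_real (v $ i)) :: complex ^ 3) \<noteq> 0"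
    using v(1) by (auto simp: vec3_eq_iff)
  \<comment> \<open>No real singular point lies at infinity: there the two remaining sixth powers
    are negatives of each other, and both are nonnegative.\<close>
  have "v $ 0 \<noteq> 0"
  proof
    assume v0: "v $ 0 = 0"
    have "dual_singular 0 (of_real ((v $ 1)^6)) (of_real ((v $ 2)^6) :: complex)"
      using sing proj_in_singular_points_iff[OF v'] v0 by (simp add: v(2))
    then have h: "(v $ 1)^6 = - ((v $ 2)^6) \<or> (v $ 1)^6 = 0 \<and> (v $ 2)^6 = 0"
      unfolding dual_singular_def quintic_node_def
      by (auto simp flip: of_real_power of_real_minus)
    have "(v $ 1)^6 = 0 \<and> (v $ 2)^6 = 0"
    proof -
      have "0 \<le> (v $ 1)^6" "0 \<le> (v $ 2)^6" by simp_all
      with h show ?thesis by linarith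
    qed
    with v(1) v0 show False by (simp add: vec3_eq_iff)
  qed
  then have "(\<chi> i. of_real (v $ i)) = of_real (v $ 0) *s
      hom_coords 1 (of_real (v $ 1 / v $ 0)) (of_real (v $ 2 / v $ 0))"
    by (simp add: vec3_eq_iff)
  then have "z = real_affine_point (vector [v $ 1 / v $ 0, v $ 2 / v $ 0])"
    using \<open>v $ 0 \<noteq> 0\<close> by (simp add: v(2) real_affine_point_eq proj_smult hom_coords_eq_0_iff)
  with sing show "z \<in> real_affine_point ` (axis_points \<union> diagonal_points)"
    using real_affine_point_in_singular_points_iff by blast
next
  fix z assume "z \<in> real_affine_point ` (axis_points \<union> diagonal_points)"
  then show "z \<in> {z \<in> singular_points q_dual. is_real z}"
    using real_affine_point_in_singular_points_iff is_real_real_affine_point by blast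
qed

lemma card_real_singular_points: "card {z \<in> singular_points q_dual. is_real z} = 8"
proof -
  have "card (axis_points \<union> diagonal_points) = 8"
    using omega_pos omega_approx
    by (simp add: axis_points_def diagonal_points_def vec_eq_iff forall_2)
  then show ?thesis
    unfolding real_singular_points
    by (simp add: card_image inj_on_def real_affine_point_eq_iff)
qed

section \<open>Irreducibility of the dual polynomial\<close>

lemma map_poly_ring_hom:
  fixes e :: "'a::comm_ring_1 \<Rightarrow> 'b::comm_ring_1"
  assumes "e 0 = 0" "e 1 = 1" and add: "\<And>x y. e (x + y) = e x + e y" and mult: "\<And>x y. e (x * y) = e x * e y"
  shows "map_poly e 1 = 1" "map_poly e (p + q) = map_poly e p + map_poly e q"
    "map_poly e (p * q) = map_poly e p * map_poly e q"
proof -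
  have sum: "e (\<Sum>x\<in>A. f x) = (\<Sum>x\<in>A. e (f x))" for f and A :: "nat set"
    by (induction A rule: infinite_finite_induct) (simp_all add: assms)
  show "map_poly e 1 = 1" "map_poly e (p + q) = map_poly e p + map_poly e q"
    "map_poly e (p * q) = map_poly e p * map_poly e q"
    by (simp_all add: poly_eq_iff coeff_map_poly assms coeff_mult sum)
qed

text \<open>Eisenstein's criterion at a simple root \<open>\<eta>\<close> of \<open>c\<close>.\<close>

lemma irreducible_power_minus_const:
  fixes c :: "complex poly"
  assumes root: "poly c \<eta> = 0" and simple: "poly (pderiv c) \<eta> \<noteq> 0" and n: "n > 0"
  shows "irreducible (monom 1 n - [:c:])"
proof (rule irreducibleI)
  let ?f = "monom 1 n - [:c:]"
  have deg: "degree ?f = n"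
  proof -
    have eq: "?f = monom 1 n + [:- c:]" by simp
    have "degree (monom (1::complex poly) n + [:- c:]) = degree (monom (1::complex poly) n)"
      using n by (intro degree_add_eq_left) (simp add: degree_monom_eq)
    then show ?thesis unfolding eq by (simp add: degree_monom_eq)
  qed
  have lead: "lead_coeff ?f = 1"
    unfolding deg using n by (cases n) simp_all
  show "?f \<noteq> 0"
    using deg n by auto
  show "\<not> ?f dvd 1"
  proof
    assume "?f dvd 1"
    then obtain g where "1 = ?f * g" by (rule dvdE)
    then have "degree ?f + degree g = 0"
      by (metis degree_1 degree_mult_eq mult_zero_left mult_zero_right one_neq_zero)
    with deg n show False by simp
  qed
  fix g h assume gh: "?f = g * h"
  \<comment> \<open>Evaluation at \<eta> is reduction modulo the prime t - \<eta>; it turns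
    \<open>?f\<close> into the pure power X^n.\<close>
  define e where "e = (\<lambda>p. poly p \<eta>)"
  have e: "e 0 = 0" "e 1 = 1" "\<And>x y. e (x + y) = e x + e y" "\<And>x y. e (x * y) = e x * e y"
    by (simp_all add: e_def)
  have "lead_coeff g * lead_coeff h = 1"
    using lead unfolding gh by (simp add: lead_coeff_mult)
  then have unit: "lead_coeff g dvd 1" "lead_coeff h dvd 1"
    by (metis dvd_triv_left, metis dvd_triv_right)
  have e_unit: "e u \<noteq> 0" if "u dvd 1" for u
    using that by (metis dvdE e(2,4) mult_zero_left one_neq_zero)
  \<comment> \<open>The reduction of \<open>k\<close> divides X^n and keeps positive degree, because
    the leading coefficient is a unit. It has a complex root, which can only be 0, so its constant
    coefficient vanishes.\<close>
  have zero: "poly (coeff k 0) \<eta> = 0"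
    if "?f = k * l" "lead_coeff k dvd 1" "degree k > 0" for k l
  proof -
    have "coeff (map_poly e k) (degree k) \<noteq> 0"
      using e_unit[OF that(2)] by (simp add: coeff_map_poly e)
    then have "degree (map_poly e k) \<ge> degree k"
      by (rule le_degree)
    with that(3) have "\<not> constant (poly (map_poly e k))"
      by (simp add: constant_degree)
    then obtain x where x: "poly (map_poly e k) x = 0"
      using fundamental_theorem_of_algebra by blast
    have "map_poly e (monom 1 n) = map_poly e ?f + map_poly e [:c:]"
      by (simp flip: map_poly_ring_hom(2)[OF e])
    also have "map_poly e [:c:] = 0"
      by (simp add: e_def root map_poly_pCons)
    finally have "monom 1 n = map_poly e k * map_poly e l"
      by (simp add: that(1) map_poly_ring_hom(3)[OF e] map_poly_monom e)
    from this[THEN arg_cong, of "\<lambda>p. poly p x"] x have "x ^ n = 0"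
      by (simp add: poly_monom)
    with x have "poly (map_poly e k) 0 = 0" by simp
    then show ?thesis
      by (simp add: poly_0_coeff_0 coeff_map_poly e e_def)
  qed
  show "g dvd 1 \<or> h dvd 1"
  proof (cases "degree g = 0 \<or> degree h = 0")
    case True
    moreover have "k dvd 1" if "degree k = 0" "lead_coeff k dvd 1" for k :: "complex poly poly"
      using that by (auto elim!: degree_eq_zeroE simp: one_pCons)
    ultimately show ?thesis
      using unit by blast
  next
    case False
    then have "poly (coeff g 0) \<eta> = 0" "poly (coeff h 0) \<eta> = 0"
      using zero[OF gh unit(1)] zero[of h g] unit(2) gh by (auto simp: mult.commute)
    moreover have "coeff g 0 * coeff h 0 = - c"
      using gh[THEN arg_cong, of "\<lambda>p. coeff p 0"] n by (simp add: coeff_mult_0)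
    \<comment> \<open>Both constant coefficients vanish at \<eta>, so by the product rule \<eta>
      would be a multiple root of \<open>c\<close>.\<close>
    then have "pderiv c = - (coeff g 0 * pderiv (coeff h 0) + coeff h 0 * pderiv (coeff g 0))"
      by (metis minus_minus pderiv_minus pderiv_mult add.commute mult.commute)
    ultimately have "poly (pderiv c) \<eta> = 0" by simp
    with simple show ?thesis by simp
  qed
qed

lemma quintic_diff_dvd: "z - w dvd quintic z a b - quintic w a b"
proof -
  have "quintic z a b - quintic w a b = (z^5 - w^5) - 5 * (a + b) * (z^4 - w^4)
      + (10 * a^2 + 10 * b^2 - 605 * a * b) * (z^3 - w^3)
      - (10 * a^3 + 10 * b^3 + 1905 * a * b^2 + 1905 * a^2 * b) * (z^2 - w^2)
      + (5 * a^4 + 5 * b^4 - 605 * a * b^3 + 1905 * a^2 * b^2 - 605 * a^3 * b) * (z - w)"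
    unfolding quintic_def by algebra
  moreover have "z - w dvd z ^ n - w ^ n" for n
    by (simp add: power_diff_sumr2)
  ultimately show ?thesis
    by (simp only: dvd_add dvd_diff dvd_mult dvd_refl)
qed

text \<open>Modulo x^6 = c the first argument becomes c^5 = ((c - 1) + 1)^5, a point of the
  parametrised curve. With c = t^6 + 1 this is the generic tangent.\<close>

lemma sextic_dvd_quintic: "x^6 - c dvd quintic (x^30) ((c - 1)^5) 1" for x c :: "'a::idom"
proof -
  have "x^6 - c dvd x^30 - c^5"
    using dvd_power_le power_diff_sumr2[of "x^6" 5 c] by (simp flip: power_mult)
  also have "\<dots> dvd quintic (x^30) ((c - 1)^5) 1 - quintic (c^5) ((c - 1)^5) 1"
    by (rule quintic_diff_dvd)
  also have "quintic (c^5) ((c - 1)^5) 1 = 0"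
    using quintic_param[of "c - 1" 1] by simp
  finally show ?thesis by simp
qed

text \<open>The Fermat sextic is irreducible, so a product vanishes on it only if a factor does.\<close>

lemma factor_vanishes_on_tangents:
  assumes "q_dual = a * b"
  shows "(\<forall>x t. x^6 = t^6 + 1 \<longrightarrow> eval_poly a (hom_coords (x^5) (t^5) 1) = 0) \<or>
    (\<forall>x t. x^6 = t^6 + 1 \<longrightarrow> eval_poly b (hom_coords (x^5) (t^5) 1) = 0)"
proof -
  define h where "h = (\<lambda>r. [:[:complex_of_real r:]:])"
  define c where "c = monom (1::complex) 6 + 1"
  define f where "f = monom 1 6 - [:c:]"
  \<comment> \<open>The generic tangent (x^5 : t^5 : 1), at the point (x : -t : -1) of the sextic.
    The outer polynomial variable is x, the inner one t.\<close>
  define v where "v = (\<lambda>i::3. if i = 0 then monom 1 5 else if i = 1 then [:monom 1 5:] else (1 :: complex poly poly))"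
  interpret coeff_hom h
    by unfold_locales (simp_all add: h_def one_pCons)
  obtain \<eta> :: complex where \<eta>: "\<eta>^6 = - 1"
    using ex_complex_nth_root[of 6 "- 1"] by auto
  have "poly c \<eta> = 0" "poly (pderiv c) \<eta> \<noteq> 0"
    using \<eta> by (auto simp: c_def poly_monom pderiv_add pderiv_monom)
  then have "irreducible f"
    unfolding f_def by (rule irreducible_power_minus_const) simp
  then have prime: "prime_elem f"
    by (rule irreducible_imp_prime_elem)
  have "eval_hom h v q_dual = quintic ((monom 1 1)^30) (([:c:] - 1)^5) 1"
    by (simp add: eval_hom_q_dual[OF coeff_hom_axioms] v_def c_def monom_power one_pCons poly_const_pow)
  moreover have "f = (monom 1 1)^6 - [:c:]"
    by (simp add: f_def monom_power)
  ultimately have "f dvd eval_hom h v q_dual"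
    using sextic_dvd_quintic[of "monom 1 1" "[:c:]"] by simp
  then have dvd: "f dvd eval_hom h v a \<or> f dvd eval_hom h v b"
    using prime by (simp add: assms eval_hom_mult prime_elem_dvd_mult_iff)
  have "\<forall>x t. x^6 = t^6 + 1 \<longrightarrow> eval_poly k (hom_coords (x^5) (t^5) 1) = 0" if "f dvd eval_hom h v k" for k
  proof (intro allI impI)
    fix x t :: complex assume xt: "x^6 = t^6 + 1"
    define \<phi> where "\<phi> = (\<lambda>F. poly (poly F [:x:]) t)"
    have \<phi>: "\<phi> (F + G) = \<phi> F + \<phi> G" "\<phi> (F * G) = \<phi> F * \<phi> G" "\<phi> 0 = 0" "\<phi> 1 = 1" for F G
      by (simp_all add: \<phi>_def)
    have "\<phi> f = 0"
      using xt by (simp add: \<phi>_def f_def c_def poly_monom poly_power)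
    then have "\<phi> (eval_hom h v k) = 0"
      using that \<phi>(2) by (metis dvdE mult_zero_left)
    moreover have "\<phi> \<circ> h = of_real"
      by (simp add: \<phi>_def h_def fun_eq_iff)
    moreover have "(\<phi> \<circ> v) i = hom_coords (x^5) (t^5) 1 $ i" for i
      by (simp add: \<phi>_def v_def hom_coords_def poly_monom poly_power)
    then have "\<phi> \<circ> v = ($) (hom_coords (x^5) (t^5) 1)"
      by blast
    ultimately show "eval_poly k (hom_coords (x^5) (t^5) 1) = 0"
      using eval_hom_compose[OF coeff_hom_axioms \<phi>, of v k] by (simp add: eval_poly_eq_eval_hom)
  qed
  with dvd show ?thesis by blast
qed

text \<open>With \<open>t\<^sup>6 = \<i>\<close>, the numbers \<open>1 + \<zeta> t\<^sup>6\<close> for \<open>\<zeta>\<^sup>5 = 1\<close> have pairwise distinct absolute values.\<close>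

lemma thirty_tangents:
  "\<exists>S (y\<^sub>1::complex). finite S \<and> card S = 30 \<and> (\<forall>y\<in>S. \<exists>x t. x^6 = t^6 + 1 \<and> x^5 = y \<and> t^5 = y\<^sub>1)"
proof -
  define Z where "Z = {\<zeta>::complex. \<zeta>^5 = 1}"
  define R where "R = (\<lambda>\<zeta>. {y::complex. y^6 = (1 + \<zeta> * \<i>)^5})"
  \<comment> \<open>Replacing t by \<zeta> t fixes t^5, hence the line y1 = t^5 y2, but turns t^6
    into \<zeta> \<i>. Each of the five values 1 + \<zeta> \<i> contributes six values of y.\<close>
  obtain t :: complex where t: "t^6 = \<i>"
    using ex_complex_nth_root[of 6 \<i>] by auto
  have Z: "finite Z" "card Z = 5"
    unfolding Z_def by (simp_all add: card_roots_unity_eq finite_roots_unity)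
  have i5: "\<i>^5 = \<i>"
    by (simp add: eval_nat_numeral)
  have nz: "(1 + \<zeta> * \<i>)^5 \<noteq> 0" if "\<zeta> \<in> Z" for \<zeta>
  proof
    assume "(1 + \<zeta> * \<i>)^5 = 0"
    then have "\<zeta> * \<i> = - 1" by (simp add: add_eq_0_iff)
    then have "\<zeta> = \<i>" by (metis i_squared minus_mult_right mult_cancel_right complex_i_not_zero power2_eq_square)
    with that i5 show False by (simp add: Z_def)
  qed
  have disj: "R \<zeta> \<inter> R \<xi> = {}" if "\<zeta> \<in> Z" "\<xi> \<in> Z" "\<zeta> \<noteq> \<xi>" for \<zeta> \<xi>
  proof (rule ccontr)
    assume "R \<zeta> \<inter> R \<xi> \<noteq> {}"
    then have "(1 + \<zeta> * \<i>)^5 = (1 + \<xi> * \<i>)^5" by (auto simp: R_def)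
    then have "cmod (1 + \<zeta> * \<i>)^5 = cmod (1 + \<xi> * \<i>)^5" by (metis norm_power)
    then have eq: "(cmod (1 + \<zeta> * \<i>))\<^sup>2 = (cmod (1 + \<xi> * \<i>))\<^sup>2"
      by (metis norm_ge_zero power_eq_imp_eq_base zero_less_numeral)
    have unit: "(cmod \<zeta>)\<^sup>2 = 1" "(cmod \<xi>)\<^sup>2 = 1"
    proof -
      have "cmod z = 1" if "z \<in> Z" for z
      proof -
        have "cmod z ^ 5 = 1" using that by (simp add: Z_def flip: norm_power)
        then show ?thesis
          using power_eq_imp_eq_base[of "cmod z" 5 1] by simp
      qed
      with that show "(cmod \<zeta>)\<^sup>2 = 1" "(cmod \<xi>)\<^sup>2 = 1" by simp_all
    qed
    then have "(Re \<zeta>)\<^sup>2 + (Im \<zeta>)\<^sup>2 = 1" "(Re \<xi>)\<^sup>2 + (Im \<xi>)\<^sup>2 = 1"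
      by (simp_all add: cmod_power2)
    moreover have "(1 - Im \<zeta>)\<^sup>2 + (Re \<zeta>)\<^sup>2 = (1 - Im \<xi>)\<^sup>2 + (Re \<xi>)\<^sup>2"
      using eq by (simp add: cmod_power2)
    ultimately have Im: "Im \<zeta> = Im \<xi>" and "(Re \<zeta>)\<^sup>2 = (Re \<xi>)\<^sup>2"
      by (simp_all add: power2_eq_square algebra_simps)
    \<comment> \<open>What is left is reflection in the imaginary axis, which would map a fifth root
      of 1 to a fifth root of -1.\<close>
    then have "Re \<zeta> = - Re \<xi>"
      using that(3) by (auto simp: power2_eq_iff complex_eq_iff)
    with Im have "\<zeta> = - cnj \<xi>" by (simp add: complex_eq_iff)
    then have "\<zeta>^5 = - cnj (\<xi>^5)" by simp
    moreover have "\<zeta>^5 = 1" "\<xi>^5 = 1"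
      using that(1,2) by (simp_all add: Z_def)
    ultimately have "(1::complex) = - cnj 1" by metis
    then show False by simp
  qed
  have R: "finite (R \<zeta>)" "card (R \<zeta>) = 6" if "\<zeta> \<in> Z" for \<zeta>
    unfolding R_def using nz[OF that] by (simp_all add: finite_nth_roots card_nth_roots)
  have "card (\<Union>\<zeta>\<in>Z. R \<zeta>) = (\<Sum>\<zeta>\<in>Z. card (R \<zeta>))"
    using Z R disj by (intro card_UN_disjoint) auto
  also have "\<dots> = 30"
    using R Z by simp
  finally have "card (\<Union>\<zeta>\<in>Z. R \<zeta>) = 30" .
  moreover have "finite (\<Union>\<zeta>\<in>Z. R \<zeta>)"
    using Z R by simp
  moreover have "\<exists>x s. x^6 = s^6 + 1 \<and> x^5 = y \<and> s^5 = t^5" if y: "y \<in> (\<Union>\<zeta>\<in>Z. R \<zeta>)" for y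
  proof -
    obtain \<zeta> where \<zeta>: "\<zeta>^5 = 1" "y^6 = (1 + \<zeta> * \<i>)^5"
      using y by (auto simp: Z_def R_def)
    obtain x where x: "x^5 = y" "x^6 = 1 + \<zeta> * \<i>"
      using power6_eq_power5_parametrization[OF \<zeta>(2)] by blast
    have "\<zeta>^6 = \<zeta> * \<zeta>^5" by (simp add: eval_nat_numeral)
    with \<zeta>(1) have "(\<zeta> * t)^6 = \<zeta> * \<i>" "(\<zeta> * t)^5 = t^5"
      by (simp_all add: power_mult_distrib t)
    with x show ?thesis
      by (intro exI[of _ x] exI[of _ "\<zeta> * t"]) simp
  qed
  ultimately show ?thesis by blast
qed

text \<open>All terms except z^5 have degree at most 24 in the polynomial variable. Monicity makes
  the leading coefficients of any two factors units.\<close>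

lemma monic_quintic:
  fixes a b :: "'a::idom"
  shows "degree (quintic (monom 1 6) [:a:] [:b:]) = 30" "lead_coeff (quintic (monom 1 6) [:a:] [:b:]) = 1"
proof -
  define z where "z = monom (1::'a) 6"
  obtain c\<^sub>0 c\<^sub>1 c\<^sub>2 c\<^sub>3 c\<^sub>4 where eq: "quintic z [:a:] [:b:] =
      ([:c\<^sub>0:] + [:c\<^sub>1:] * z + [:c\<^sub>2:] * z^2 + [:c\<^sub>3:] * z^3 + [:c\<^sub>4:] * z^4) + z^5"
  proof -
    have "quintic z p q =
        (- ((p + q)^5) + (5 * p^4 + 5 * q^4 - 605 * p * q^3 + 1905 * p^2 * q^2 - 605 * p^3 * q) * z
        + (- (10 * p^3 + 10 * q^3 + 1905 * p * q^2 + 1905 * p^2 * q)) * z^2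
        + (10 * p^2 + 10 * q^2 - 605 * p * q) * z^3 + (- (5 * (p + q))) * z^4) + z^5" for p q
      unfolding quintic_def by algebra
    from this[of "[:a:]" "[:b:]"] have "quintic z [:a:] [:b:] =
        ([:- ((a+b)^5):] + [:5 * a^4 + 5 * b^4 - 605 * a * b^3 + 1905 * a^2 * b^2 - 605 * a^3 * b:] * z
        + [:- (10 * a^3 + 10 * b^3 + 1905 * a * b^2 + 1905 * a^2 * b):] * z^2
        + [:10 * a^2 + 10 * b^2 - 605 * a * b:] * z^3 + [:- (5 * (a+b)):] * z^4) + z^5"
      by (simp add: poly_const_pow numeral_poly mult.commute mult.left_commute)
    then show thesis by (rule that)
  qed
  have "[:c:] * z ^ n = monom c (6 * n)" for c n
    by (simp add: z_def monom_power smult_monom mult.commute)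
  then have "degree ([:c:] * z ^ n) \<le> 24" if "n \<le> 4" for c n
    using that degree_monom_le[of c "6 * n"] by simp
  from this[of 0] this[of 1] this[of 2] this[of 3] this[of 4]
  have le: "degree ([:c\<^sub>0:] + [:c\<^sub>1:] * z + [:c\<^sub>2:] * z^2 + [:c\<^sub>3:] * z^3 + [:c\<^sub>4:] * z^4) \<le> 24"
    by (intro degree_add_le) simp_all
  have z5: "z^5 = monom 1 30"
    by (simp add: z_def monom_power)
  then have "degree (z^5) = 30" "lead_coeff (z^5) = 1"
    by (simp_all add: degree_monom_eq)
  moreover obtain r where "quintic z [:a:] [:b:] = r + z^5" "degree r \<le> 24"
    using eq le by blast
  ultimately show "degree (quintic (monom 1 6) [:a:] [:b:]) = 30" "lead_coeff (quintic (monom 1 6) [:a:] [:b:]) = 1"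
    unfolding z_def[symmetric] by (simp_all add: degree_add_eq_right lead_coeff_add_le coeff_eq_0)
qed

text \<open>Seen as a polynomial in \<open>y0\<close> over \<open>ternary_poly\<close>, the product
  is monic of degree 30. A factor of degree 30 leaves a cofactor that is constant in
  \<open>y0\<close>, and this constant is a leading coefficient, hence a unit.\<close>

lemma cofactor_of_tangents_unit:
  assumes q: "q_dual = a * b"
    and vanish: "\<And>x t. x^6 = t^6 + 1 \<Longrightarrow> eval_poly a (hom_coords (x^5) (t^5) 1) = 0"
  shows "b dvd 1"
proof -
  define h :: "real \<Rightarrow> ternary_poly poly" where "h = (\<lambda>r. [:Poly_Mapping.single 0 r:])"
  define v :: "3 \<Rightarrow> ternary_poly poly" where "v = (\<lambda>i. if i = 0 then [:0, 1:] else [:Var i:])"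
  interpret coeff_hom h
    using coeff_hom_single by (auto simp: coeff_hom_def h_def one_pCons)
  define A where "A = eval_hom h v a"
  define B where "B = eval_hom h v b"
  have "A * B = eval_hom h v q_dual"
    by (simp add: A_def B_def q eval_hom_mult)
  also have "\<dots> = quintic (monom 1 6) [:Var 1 ^ 6:] [:Var 2 ^ 6:]"
    by (simp add: eval_hom_q_dual[OF coeff_hom_axioms] v_def poly_const_pow monom_altdef)
  finally have AB: "degree (A * B) = 30" "lead_coeff (A * B) = 1"
    using monic_quintic by simp_all
  obtain S and y\<^sub>1 :: complex where S: "finite S" "card S = 30"
    "\<forall>y\<in>S. \<exists>x t. x^6 = t^6 + 1 \<and> x^5 = y \<and> t^5 = y\<^sub>1"
    using thirty_tangents by blast
  \<comment> \<open>Restriction of the coefficients to the line. The first coordinate 0 is a dummy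
    value: \<open>v\<close> sends \<open>Var 0\<close> to the polynomial variable, so it does not
    enter the coefficients.\<close>
  define e where "e = (\<lambda>p. eval_poly p (hom_coords 0 y\<^sub>1 1))"
  have e: "e 0 = 0" "e 1 = 1" "\<And>x y. e (x + y) = e x + e y" "\<And>x y. e (x * y) = e x * e y"
    by (simp_all add: e_def eval_poly_simps)
  have root: "poly (map_poly e A) y = 0" if y: "y \<in> S" for y
  proof -
    define \<phi> where "\<phi> = (\<lambda>P. poly (map_poly e P) y)"
    have \<phi>: "\<phi> (F + G) = \<phi> F + \<phi> G" "\<phi> (F * G) = \<phi> F * \<phi> G" "\<phi> 0 = 0" "\<phi> 1 = 1" for F G
      by (simp_all add: \<phi>_def map_poly_ring_hom[OF e])
    have const: "\<phi> [:k:] = e k" and lin: "\<phi> [:0, 1:] = y" for k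
      by (simp_all add: \<phi>_def map_poly_pCons e)
    have "e (Poly_Mapping.single 0 r) = of_real r" for r
      by (simp add: e_def eval_poly_eq_eval_hom of_real_complex.eval_hom_single)
    then have "\<phi> \<circ> h = of_real"
      by (simp add: h_def fun_eq_iff const)
    moreover have "(\<phi> \<circ> v) i = hom_coords y y\<^sub>1 1 $ i" for i
      by (simp add: v_def const lin) (simp add: e_def eval_poly_simps hom_coords_def)
    then have "\<phi> \<circ> v = ($) (hom_coords y y\<^sub>1 1)"
      by blast
    ultimately have "\<phi> A = eval_poly a (hom_coords y y\<^sub>1 1)"
      unfolding A_def using eval_hom_compose[OF coeff_hom_axioms \<phi>, of v a] by (simp add: eval_poly_eq_eval_hom)
    also have "\<dots> = 0"
    proof -
      obtain x t where "x^6 = t^6 + 1" "x^5 = y" "t^5 = y\<^sub>1"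
        using bspec[OF S(3) y] by (elim exE conjE)
      then show ?thesis using vanish by blast
    qed
    finally show ?thesis by (simp add: \<phi>_def)
  qed
  have lead: "lead_coeff A * lead_coeff B = 1"
    using AB(2) by (simp add: lead_coeff_mult)
  then have "e (lead_coeff A) * e (lead_coeff B) = 1"
    by (metis e(2,4))
  \<comment> \<open>A unit stays nonzero under specialisation, so the restricted factor is not the
    zero polynomial and its roots bound its degree.\<close>
  then have "coeff (map_poly e A) (degree A) \<noteq> 0"
    by (auto simp: coeff_map_poly e)
  then have "map_poly e A \<noteq> 0" by auto
  then have "card S \<le> degree (map_poly e A)"
    using root card_mono[of "{x. poly (map_poly e A) x = 0}" S] card_poly_roots_bound[of "map_poly e A"]
      poly_roots_finite[of "map_poly e A"] by (simp add: subset_iff)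
  also have "\<dots> \<le> degree A"
    by (rule degree_le) (simp add: coeff_map_poly e coeff_eq_0)
  finally have "degree A \<ge> 30"
    by (simp add: S(2))
  moreover have "degree A + degree B = 30"
    using AB by (metis degree_mult_eq leading_coeff_0_iff mult_zero_left mult_zero_right zero_neq_one)
  ultimately have "degree B = 0" by simp
  then obtain c where c: "B = [:c:]"
    by (rule degree_eq_zeroE)
  \<comment> \<open>Putting \<open>Var 0\<close> back for the polynomial variable returns
    \<open>b\<close> from \<open>B\<close>.\<close>
  define \<psi> where "\<psi> = (\<lambda>P :: ternary_poly poly. poly P (Var 0))"
  have \<psi>: "\<psi> (F + G) = \<psi> F + \<psi> G" "\<psi> (F * G) = \<psi> F * \<psi> G" "\<psi> 0 = 0" "\<psi> 1 = 1" for F G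
    by (simp_all add: \<psi>_def)
  have "\<psi> \<circ> h = Poly_Mapping.single 0" "\<psi> \<circ> v = Var"
    by (simp_all add: \<psi>_def h_def v_def fun_eq_iff)
  then have "\<psi> B = b"
    unfolding B_def using eval_hom_compose[OF coeff_hom_axioms \<psi>, of v b] by (simp add: eval_hom_id)
  then have "b = c" by (simp add: \<psi>_def c)
  with lead c show ?thesis
    by (metis coeff_pCons_0 degree_pCons_0 dvd_triv_right)
qed

lemma irreducible_q_dual: "irreducible q_dual"
proof (rule irreducibleI)
  have "eval_poly q_dual (hom_coords 1 0 0) = 1"
    by (simp add: eval_q_dual quintic_def)
  then show "q_dual \<noteq> 0"
    by (auto simp: eval_poly_simps)
  have "eval_poly q_dual (hom_coords 1 1 0) = 0"
    by (simp add: eval_q_dual quintic_def)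
  then show "\<not> q_dual dvd 1"
    using eval_poly_simps(2,4) by (metis dvdE mult_zero_left zero_neq_one)
  fix a b assume q: "q_dual = a * b"
  then have "q_dual = b * a" by (simp add: mult.commute)
  with q show "a dvd 1 \<or> b dvd 1"
    using factor_vanishes_on_tangents[OF q] cofactor_of_tangents_unit by blast
qed

section \<open>Poles and polars\<close>

lemma proj_in_polar_iff:
  assumes "u \<noteq> 0" "v \<noteq> 0"
  shows "proj v \<in> polar (proj u) \<longleftrightarrow> u $ 0 * v $ 0 + u $ 1 * v $ 1 + u $ 2 * v $ 2 = 0"
proof
  assume "proj v \<in> polar (proj u)"
  then obtain u' v' where uv': "u' \<noteq> 0" "v' \<noteq> 0" "proj u = proj u'" "proj v = proj v'"
    "u' $ 0 * v' $ 0 + u' $ 1 * v' $ 1 + u' $ 2 * v' $ 2 = 0"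
    unfolding polar_def sum_3_from_0 by blast
  then obtain c d where "c \<noteq> 0" "u' = c *s u" "d \<noteq> 0" "v' = d *s v"
    using proj_eq_iff assms by metis
  with uv'(5) have "c * d * (u $ 0 * v $ 0 + u $ 1 * v $ 1 + u $ 2 * v $ 2) = 0"
    by (simp add: algebra_simps)
  with \<open>c \<noteq> 0\<close> \<open>d \<noteq> 0\<close> show "u $ 0 * v $ 0 + u $ 1 * v $ 1 + u $ 2 * v $ 2 = 0"
    by simp
qed (use assms in \<open>auto simp: polar_def sum_3_from_0\<close>)

lemma real_affine_point_in_polar_iff:
  assumes "u \<noteq> 0"
  shows "real_affine_point y \<in> polar (proj u) \<longleftrightarrow>
    u $ 0 + u $ 1 * of_real (y $ 1) + u $ 2 * of_real (y $ 2) = 0"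
  unfolding real_affine_point_eq using assms
  by (subst proj_in_polar_iff) (auto simp: hom_coords_eq_0_iff)

lemma inner_2: "x \<bullet> y = x $ 1 * y $ 1 + x $ 2 * y $ 2" for x y :: "real ^ 2"
  by (simp add: inner_vec_def sum_2)

text \<open>Two distinct real points determine a complex line, so even a pole that is not assumed
  real must be the expected one.\<close>

lemma is_pole_of_real_affine_line_iff:
  fixes x :: "real ^ 2"
  assumes "x \<noteq> 0"
  shows "is_pole_of_real_affine_line z {y. x \<bullet> y = - r} \<longleftrightarrow>
    z = proj (hom_coords (of_real r) (of_real (x $ 1)) (of_real (x $ 2)))"
proof
  let ?p = "hom_coords (of_real r) (of_real (x $ 1)) (of_real (x $ 2))"
  have x: "x $ 1 \<noteq> 0 \<or> x $ 2 \<noteq> 0"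
    using assms by (auto simp: vec_eq_iff forall_2)
  then have p: "?p \<noteq> 0"
    by (auto simp: hom_coords_eq_0_iff)
  {
    assume "z = proj ?p"
    moreover have "of_real r + of_real (x $ 1) * of_real (y $ 1) + of_real (x $ 2) * of_real (y $ 2)
        = (of_real (r + x \<bullet> y) :: complex)" for y
      by (simp add: inner_2)
    ultimately show "is_pole_of_real_affine_line z {y. x \<bullet> y = - r}"
      by (auto simp: is_pole_of_real_affine_line_def real_affine_part_def
          real_affine_point_in_polar_iff[OF p] simp del: of_real_add)
  next
    assume pole: "is_pole_of_real_affine_line z {y. x \<bullet> y = - r}"
    obtain u where u: "u \<noteq> 0" "z = proj u" by (rule cp2_cases)
    define n where "n = (x $ 1)^2 + (x $ 2)^2"
    have n: "n > 0"
      using x by (auto simp: n_def sum_power2_gt_zero_iff)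
    have line: "u $ 0 + u $ 1 * of_real (y $ 1) + u $ 2 * of_real (y $ 2) = 0" if "x \<bullet> y = - r" for y
      using pole that real_affine_point_in_polar_iff[OF u(1)]
      by (auto simp: is_pole_of_real_affine_line_def real_affine_part_def u(2))
    define X Y R N where "X = complex_of_real (x $ 1)" and "Y = complex_of_real (x $ 2)"
      and "R = complex_of_real r" and "N = complex_of_real n"
    \<comment> \<open>The point used is the foot of the perpendicular from the origin, moved by k
      times the direction (-x2, x1). The values k = 0 and k = 1 give two points of the line.\<close>
    have eq: "u $ 0 + u $ 1 * (- R * X / N - of_real k * Y) + u $ 2 * (- R * Y / N + of_real k * X) = 0" for k
    proof -
      have "x $ 1 * (- r * x $ 1 / n - k * x $ 2) + x $ 2 * (- r * x $ 2 / n + k * x $ 1)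
          = - r * ((x $ 1)^2 + (x $ 2)^2) / n"
        by (simp add: algebra_simps power2_eq_square add_divide_distrib diff_divide_distrib)
      also have "\<dots> = - r"
        using n by (simp flip: n_def)
      finally show ?thesis
        using line[of "vector [- r * x $ 1 / n - k * x $ 2, - r * x $ 2 / n + k * x $ 1]"]
        by (simp add: inner_2 X_def Y_def R_def N_def)
    qed
    have N: "N \<noteq> 0"
      using n by (simp add: N_def)
    have N': "N = X^2 + Y^2"
      by (simp add: N_def X_def Y_def n_def)
    have e0: "u $ 0 - (u $ 1 * X + u $ 2 * Y) * R / N = 0"
      using eq[of 0] by (simp add: algebra_simps add_divide_distrib)
    have "p + q * (k - c * Y) + w * (l + c * X) = 0 \<Longrightarrow> p + q * (k - d * Y) + w * (l + d * X) = 0 \<Longrightarrow>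
        (c - d) * (q * Y) = (c - d) * (w * X)" for p q w k l c d
      by algebra
    from this[OF eq[of 1] eq[of 0]] have e1: "u $ 1 * Y = u $ 2 * X" by simp
    define c where "c = (u $ 1 * X + u $ 2 * Y) / N"
    have "c * N = u $ 1 * X + u $ 2 * Y"
      using N by (simp add: c_def)
    have "u $ 1 * N = X * (u $ 1 * X + u $ 2 * Y)"
      unfolding N' using e1 by algebra
    moreover have "u $ 2 * N = Y * (u $ 1 * X + u $ 2 * Y)"
      unfolding N' using e1 by algebra
    ultimately have "u $ 1 * N = (X * c) * N" "u $ 2 * N = (Y * c) * N"
      by (simp_all flip: \<open>c * N = _\<close>)
    then have "u $ 1 = c * X" "u $ 2 = c * Y"
      using N by (simp_all add: mult.commute)
    moreover have "u $ 0 = c * R"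
      using e0 by (simp add: c_def)
    ultimately have "u = c *s ?p"
      by (simp add: vec3_eq_iff X_def Y_def R_def)
    moreover from this have "c \<noteq> 0"
      using u(1) by auto
    ultimately show "z = proj ?p"
      using p u(2) by (simp add: proj_smult)
  }
qed

lemma real_affine_point_in_sextic_iff:
  "real_affine_point x \<in> curve p_sextic \<longleftrightarrow> (x $ 1)^6 + (x $ 2)^6 = 1"
proof -
  have "real_affine_point x \<in> curve p_sextic \<longleftrightarrow>
      1 - complex_of_real (x $ 1)^6 - complex_of_real (x $ 2)^6 = 0"
    unfolding real_affine_point_eq
    by (subst proj_in_curve_iff[OF homogeneous_p_sextic]) (auto simp: hom_coords_eq_0_iff eval_p_sextic)
  also have "\<dots> \<longleftrightarrow> complex_of_real (1 - (x $ 1)^6 - (x $ 2)^6) = of_real 0"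
    by simp
  also have "\<dots> \<longleftrightarrow> (x $ 1)^6 + (x $ 2)^6 = 1"
    unfolding of_real_eq_iff by auto
  finally show ?thesis .
qed

section \<open>The convex set\<close>

text \<open>The norm dual to the 6-norm, raised to the power 6/5.\<close>

definition dual_gauge :: "real ^ 2 \<Rightarrow> real" where
  "dual_gauge y = root 5 (y $ 1)^6 + root 5 (y $ 2)^6"

lemma root5_power5: "root 5 y ^ 5 = y"
  by (rule odd_real_root_pow) simp

text \<open>Young's inequality for the exponents 6 and 6/5, certified by a sum of squares times (x -
  r)^2.\<close>

lemma young_6: "6 * x * r^5 \<le> x^6 + 5 * r^6" for x r :: real
proof -
  have "x^6 + 5 * r^6 - 6 * x * r^5 = (x - r)^2 * ((x^2 + x * r)^2 + 2 * (x * r + r^2)^2 + 3 * (r^2)^2)"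
    by algebra
  also have "\<dots> \<ge> 0" by simp
  finally show ?thesis by simp
qed

text \<open>Hoelder's inequality for the exponents 6 and 6/5, obtained from Young's by scaling x to
  6-norm one.\<close>

lemma inner_ge_dual_gauge:
  assumes "dual_gauge y \<le> 1"
  shows "x \<bullet> y \<ge> - root 6 ((x $ 1)^6 + (x $ 2)^6)"
proof -
  define m where "m = root 6 ((x $ 1)^6 + (x $ 2)^6)"
  have m6: "m^6 = (x $ 1)^6 + (x $ 2)^6" and "m \<ge> 0"
    by (simp_all add: m_def)
  show ?thesis
  proof (cases "m = 0")
    case True
    then have "x $ 1 = 0" "x $ 2 = 0"
      using m6 add_nonneg_eq_0_iff[of "(x $ 1)^6" "(x $ 2)^6"] by simp_all
    then show ?thesis by (simp add: inner_2)
  next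
    case False
    have young: "- (x $ i * y $ i / m) \<le> ((x $ i / m)^6 + 5 * root 5 (y $ i)^6) / 6" for i
      using young_6[of "- (x $ i) / m" "root 5 (y $ i)"] by (simp add: root5_power5 mult_ac)
    have "(x $ 1 / m)^6 + (x $ 2 / m)^6 = 1"
    proof -
      have "(x $ 1 / m)^6 + (x $ 2 / m)^6 = ((x $ 1)^6 + (x $ 2)^6) / m^6"
        by (simp add: power_divide add_divide_distrib)
      then show ?thesis using False by (simp flip: m6)
    qed
    then have "- (x \<bullet> y) / m \<le> 1"
      using young[of 1] young[of 2] assms
      by (simp add: inner_2 dual_gauge_def add_divide_distrib diff_divide_distrib)
    then show ?thesis
      using False \<open>m \<ge> 0\<close> by (simp add: field_simps flip: m_def)
  qed
qed

lemma dual_gauge_scale: "dual_gauge (c *\<^sub>R y) = root 5 c ^ 6 * dual_gauge y"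
  by (simp add: dual_gauge_def real_root_mult power_mult_distrib algebra_simps)

lemma continuous_on_dual_gauge: "continuous_on S dual_gauge"
  unfolding dual_gauge_def[abs_def] by (intro continuous_intros)

context
  fixes W :: "(real ^ 2) set"
  assumes compact: "compact W" and convex: "convex W" and nonempty: "W \<noteq> {}"
    and support: "\<And>x. support_fun W x = - root 6 ((x $ 1)^6 + (x $ 2)^6)"
begin

lemma W_eq_dual_gauge: "W = {y. dual_gauge y \<le> 1}"
proof (intro set_eqI iffI)
  fix y assume "y \<in> W"
  define N where "N = dual_gauge y"
  \<comment> \<open>The direction of equality in Hoelder's inequality: the inner product with y is
    -N while the support function is - root 6 N, which forces N \<le> 1.\<close>
  define x :: "real ^ 2" where "x = vector [- root 5 (y $ 1), - root 5 (y $ 2)]"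
  have "bounded ((\<bullet>) x ` W)"
    using compact by (intro compact_imp_bounded compact_continuous_image continuous_intros)
  then have "support_fun W x \<le> x \<bullet> y"
    unfolding support_fun_def using \<open>y \<in> W\<close> by (intro cINF_lower bounded_imp_bdd_below)
  moreover have "support_fun W x = - root 6 N"
    by (simp add: support x_def N_def dual_gauge_def)
  moreover have "x \<bullet> y = - N"
  proof -
    have "root 5 t * t = root 5 t ^ 6" for t
    proof -
      have "z^6 = z * z^5" for z :: real by (simp add: eval_nat_numeral)
      then show ?thesis by (simp add: root5_power5)
    qed
    then show ?thesis by (simp add: inner_2 x_def N_def dual_gauge_def)
  qed
  ultimately have le: "N \<le> root 6 N" by simp
  have "N \<ge> 0" by (simp add: N_def dual_gauge_def)
  then have "N^6 \<le> N"
    using power_mono[OF le, of 6] by simp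
  then have "N \<le> 1"
    using power_strict_increasing[of 1 6 N] by (cases "N > 1") simp_all
  then show "y \<in> {y. dual_gauge y \<le> 1}"
    by (simp add: N_def)
next
  fix y assume y: "y \<in> {y. dual_gauge y \<le> 1}"
  show "y \<in> W"
  proof (rule ccontr)
    assume "y \<notin> W"
    then obtain a b where ab: "a \<bullet> y < b" "\<forall>x\<in>W. b < a \<bullet> x"
      using separating_hyperplane_closed_point[of W y] convex compact compact_imp_closed by blast
    have "b \<le> support_fun W a"
      unfolding support_fun_def using ab(2) nonempty by (intro cINF_greatest) (auto intro: less_imp_le)
    then show False
      using ab(1) inner_ge_dual_gauge[of y a] y by (simp add: support)
  qed
qed

lemma frontier_W: "frontier W = {y. dual_gauge y = 1}"
proof -
  have "y \<in> interior W \<longleftrightarrow> dual_gauge y < 1" for y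
  proof
    assume "dual_gauge y < 1"
    moreover have "open {y. dual_gauge y < 1}"
      by (intro open_Collect_less continuous_on_dual_gauge continuous_on_const)
    moreover have "{y. dual_gauge y < 1} \<subseteq> W"
      by (auto simp: W_eq_dual_gauge)
    ultimately show "y \<in> interior W"
      using interiorI by blast
  next
    assume "y \<in> interior W"
    then obtain e where e: "e > 0" "ball y e \<subseteq> W"
      by (auto simp: mem_interior)
    \<comment> \<open>A radial step of length less than e. The gauge is homogeneous of degree 6/5,
      so from gauge at least 1 this step would leave W.\<close>
    define d where "d = e / (2 * (norm y + 1))"
    have d: "d > 0" using e by (simp add: d_def add_nonneg_pos)
    have "d * norm y < e"
    proof -
      have "d * norm y \<le> d * (norm y + 1)" using d by simp
      also have "\<dots> = e / 2"
        using norm_ge_zero[of y] by (simp add: d_def field_simps add_nonneg_eq_0_iff)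
      finally show ?thesis using e by simp
    qed
    then have "(1 + d) *\<^sub>R y \<in> ball y e"
      using d by (simp add: dist_norm algebra_simps)
    then have le: "root 5 (1 + d) ^ 6 * dual_gauge y \<le> 1"
      using e(2) by (auto simp: W_eq_dual_gauge dual_gauge_scale)
    have "root 5 (1 + d) > 1"
      using d by simp
    then have "root 5 (1 + d) ^ 6 > 1"
      by (rule one_less_power) simp
    show "dual_gauge y < 1"
    proof (rule ccontr)
      assume "\<not> dual_gauge y < 1"
      then have "root 5 (1 + d) ^ 6 * 1 \<le> root 5 (1 + d) ^ 6 * dual_gauge y"
        by (intro mult_left_mono) auto
      with le \<open>root 5 (1 + d) ^ 6 > 1\<close> show False by simp
    qed
  qed
  then show ?thesis
    unfolding frontier_def closure_closed[OF compact_imp_closed[OF compact]]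
    by (auto simp: W_eq_dual_gauge)
qed

end

section \<open>Real points of the dual curve\<close>

lemma fifth_root_cases:
  assumes "z^5 = 1"
  shows "z = 1 \<or> (Re z = (sqrt 5 - 1) / 4 \<or> Re z = - (sqrt 5 + 1) / 4)"
    and "(Re z)^2 + (Im z)^2 = 1"
proof -
  have "cmod z ^ 5 = 1"
    using assms by (simp flip: norm_power)
  then have "cmod z = 1"
    using power_eq_imp_eq_base[of "cmod z" 5 1] by simp
  then show unit: "(Re z)^2 + (Im z)^2 = 1"
    by (simp flip: cmod_power2)
  show "z = 1 \<or> (Re z = (sqrt 5 - 1) / 4 \<or> Re z = - (sqrt 5 + 1) / 4)"
  proof (cases "z = 1")
    case False
    have inv: "z * cnj z = 1"
      using \<open>cmod z = 1\<close> by (simp add: complex_norm_square[symmetric])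
    have "(z - 1) * (z^4 + z^3 + z^2 + z + 1) = 0"
      using assms by algebra
    with False have "z^4 + z^3 + z^2 + z + 1 = 0" by simp
    \<comment> \<open>Dividing the cyclotomic equation by z^2 gives a quadratic for z + z^-1 = 2 Re
      z.\<close>
    then have "(z + cnj z)^2 + (z + cnj z) - 1 = 0"
      using inv by algebra
    then have "complex_of_real ((2 * Re z)^2 + 2 * Re z - 1) = of_real 0"
      by (simp add: complex_add_cnj)
    then have "(2 * Re z)^2 + 2 * Re z - 1 = 0"
      unfolding of_real_eq_iff .
    moreover have "(2 * Re z)^2 + 2 * Re z - 1 = 4 * ((Re z - (sqrt 5 - 1) / 4) * (Re z - (- (sqrt 5 + 1) / 4)))"
      by (simp add: field_simps power2_eq_square)
    ultimately show ?thesis by simp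
  qed simp
qed

text \<open>The imaginary parts must cancel. If one root is 1, the other term is real and the sum is
  1. If the real parts agree and neither root is 1, then s = t, and the real part must be positive,
  namely the cosine of 72 degrees, which yields the golden ratio. Different real parts are
  impossible.\<close>

lemma nonneg_combination_of_fifth_roots:
  assumes a: "a^5 = 1" and b: "b^5 = 1" and s: "s \<ge> 0" and t: "t \<ge> 0"
    and eq: "a * complex_of_real s + b * complex_of_real t = 1"
  shows "s + t = 1 \<or> s = (sqrt 5 + 1) / 2 \<and> t = (sqrt 5 + 1) / 2"
proof -
  have Re: "Re a * s + Re b * t = 1" and Im: "Im a * s + Im b * t = 0"
    using eq by (simp_all add: complex_eq_iff)
  have sqrt5: "sqrt 5 > 2" "(sqrt 5)^2 = 5"
    by (auto intro!: real_less_rsqrt)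
  have one: "s + t = 1"
    if "b^5 = 1" "Re b * t + s = 1" "Im b * t = 0" "s \<ge> 0" "t \<ge> 0" for b s t
  proof (cases "t = 0")
    case False
    with that have "Im b = 0" by simp
    then have "b = complex_of_real (Re b)" by (simp add: complex_eq_iff)
    with that(1) have "complex_of_real (Re b ^ 5) = of_real 1" by (metis of_real_power of_real_1)
    then have "Re b ^ 5 = 1 ^ 5" unfolding of_real_eq_iff by simp
    then have "Re b = 1" by (metis odd_numeral odd_real_root_power_cancel)
    with that(2) show ?thesis by simp
  qed (use that in simp)
  \<comment> \<open>Cancelling imaginary parts gives s \<le> t because \<open>a\<close> has the
    larger imaginary part in absolute value, whereas the real parts give s > t.\<close>
  have mixed: False
    if "Re a = (sqrt 5 - 1) / 4" "Re b = - (sqrt 5 + 1) / 4" "(Re a)^2 + (Im a)^2 = 1" "(Re b)^2 + (Im b)^2 = 1"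
      "Re a * s + Re b * t = 1" "Im a * s + Im b * t = 0" "s \<ge> 0" "t \<ge> 0" for a b s t
  proof -
    have Ima: "(Im a)^2 = (5 + sqrt 5) / 8" and Imb: "(Im b)^2 = (5 - sqrt 5) / 8"
    proof -
      have "((sqrt 5 - 1) / 4)^2 = (3 - sqrt 5) / 8" "(- (sqrt 5 + 1) / 4)^2 = (3 + sqrt 5) / 8"
        by (simp_all add: power2_eq_square field_simps)
      then have "(Im a)^2 = 1 - (3 - sqrt 5) / 8" "(Im b)^2 = 1 - (3 + sqrt 5) / 8"
        using that(3,4) unfolding that(1,2) by linarith+
      then show "(Im a)^2 = (5 + sqrt 5) / 8" "(Im b)^2 = (5 - sqrt 5) / 8"
        by (simp_all add: diff_divide_distrib add_divide_distrib)
    qed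
    have "Im a * s = - (Im b * t)"
      using that(6) by simp
    then have "(Im a * s)^2 = (Im b * t)^2" by simp
    then have sq: "(5 + sqrt 5) * s^2 = (5 - sqrt 5) * t^2"
      by (simp add: power_mult_distrib Ima Imb)
    have "(sqrt 5 - 1) * s = 4 + (sqrt 5 + 1) * t"
      using that(5) unfolding that(1,2) by (simp add: field_simps)
    then have "(sqrt 5 - 1) * s > (sqrt 5 - 1) * t"
      using that(8) sqrt5(1) by (simp add: algebra_simps)
    then have "s > t" using sqrt5(1) by simp
    then have "s^2 > t^2" using that(8) by (simp add: power_strict_mono)
    then have "(5 + sqrt 5) * s^2 > (5 + sqrt 5) * t^2" using sqrt5(1) by simp
    moreover have "(5 + sqrt 5) * t^2 \<ge> (5 - sqrt 5) * t^2" using sqrt5(1) by (intro mult_right_mono) auto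
    ultimately show False using sq by linarith
  qed
  have same: "s = (sqrt 5 + 1) / 2 \<and> t = (sqrt 5 + 1) / 2"
    if "Re a = Re b" "Re a \<noteq> 1" "Re a \<noteq> - 1" "Re a = (sqrt 5 - 1) / 4 \<or> Re a = - (sqrt 5 + 1) / 4"
  proof -
    have "(Im a)^2 = (Im b)^2"
      using fifth_root_cases(2)[OF a] fifth_root_cases(2)[OF b] that(1) by simp
    moreover have "(Im a * s)^2 = (Im b * t)^2"
      using Im by (metis add_eq_0_iff power2_minus)
    moreover have "(Im a)^2 \<noteq> 0"
      using fifth_root_cases(2)[OF a] that(2,3) by (auto simp: power2_eq_1_iff)
    ultimately have "s^2 = t^2" by (simp add: power_mult_distrib)
    then have "s = t" using s t by simp
    with Re that(1) have unit: "2 * Re a * s = 1"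
      by (simp add: mult_ac)
    have "Re a > 0"
    proof (rule ccontr)
      assume "\<not> Re a > 0"
      then have "Re a * s \<le> 0" using s by (intro mult_nonpos_nonneg) auto
      with unit show False by simp
    qed
    then have Re_a: "Re a = (sqrt 5 - 1) / 4"
      using that(4) sqrt5(1) by auto
    have "(sqrt 5 - 1) * s = 2"
      using unit unfolding Re_a by (simp add: field_simps)
    moreover have "(sqrt 5 - 1) * ((sqrt 5 + 1) / 2) = 2"
      by (simp add: field_simps)
    ultimately have "(sqrt 5 - 1) * s = (sqrt 5 - 1) * ((sqrt 5 + 1) / 2)" by simp
    then have "s = (sqrt 5 + 1) / 2"
      using sqrt5(1) by simp
    with \<open>s = t\<close> show ?thesis by simp
  qed
  show ?thesis
  proof (cases "a = 1 \<or> b = 1")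
    case True
    then show ?thesis
      using one[where b = b and s = s and t = t] one[where b = a and s = t and t = s] Re Im a b s t
      by (auto simp: add.commute)
  next
    case False
    then have Re_ab: "Re a = (sqrt 5 - 1) / 4 \<or> Re a = - (sqrt 5 + 1) / 4"
      "Re b = (sqrt 5 - 1) / 4 \<or> Re b = - (sqrt 5 + 1) / 4"
      using fifth_root_cases(1)[OF a] fifth_root_cases(1)[OF b] by auto
    have "sqrt 5 < 3" by (rule real_less_lsqrt) simp_all
    then have "Re a \<noteq> 1" "Re a \<noteq> - 1"
      using Re_ab(1) sqrt5(1) by auto
    note same' = same[OF _ this Re_ab(1)]
    note unit = fifth_root_cases(2)[OF a] fifth_root_cases(2)[OF b]
    have Re': "Re b * t + Re a * s = 1" and Im': "Im b * t + Im a * s = 0"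
      using Re Im by (simp_all add: add.commute)
    consider "Re a = Re b" | "Re a = (sqrt 5 - 1) / 4" "Re b = - (sqrt 5 + 1) / 4"
      | "Re b = (sqrt 5 - 1) / 4" "Re a = - (sqrt 5 + 1) / 4"
      using Re_ab by metis
    then show ?thesis
    proof cases
      case 1
      then show ?thesis using same' by blast
    next
      case 2
      then show ?thesis using mixed[OF 2 unit Re Im s t] by blast
    next
      case 3
      then show ?thesis using mixed[OF 3 unit(2,1) Re' Im' t s] by blast
    qed
  qed
qed

text \<open>Explains \<omega>: at the isolated points s = t is the golden ratio, and y^6 =
  s^5.\<close>

lemma golden_power5: "((sqrt 5 + 1) / 2)^5 = node_coord"
proof -
  have "(u + 1)^5 = u * (u^2)^2 + 5 * (u^2)^2 + 10 * u * u^2 + 10 * u^2 + 5 * u + 1" for u :: real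
    by algebra
  from this[of "sqrt 5"] have "(sqrt 5 + 1)^5 = 16 * (11 + 5 * sqrt 5)" by simp
  then show ?thesis by (simp add: power_divide node_coord_def)
qed

lemma real_affine_point_in_dual_curve_iff:
  "real_affine_point y \<in> curve q_dual \<longleftrightarrow> dual_gauge y = 1 \<or> y \<in> diagonal_points"
proof -
  \<comment> \<open>Nonnegative real fifth roots of the sixth powers are fixed here, so the only
    freedom left in the parametrisation is a fifth root of unity.\<close>
  define s where "s = root 5 (y $ 1)^6"
  define t where "t = root 5 (y $ 2)^6"
  have st: "s \<ge> 0" "t \<ge> 0" "(y $ 1)^6 = s^5" "(y $ 2)^6 = t^5" "dual_gauge y = s + t"
  proof -
    have "z^6 = (root 5 z ^ 6)^5" for z :: real
      by (metis root5_power5 power_mult mult.commute)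
    then show "(y $ 1)^6 = s^5" "(y $ 2)^6 = t^5" unfolding s_def t_def by blast+
  qed (simp_all add: s_def t_def dual_gauge_def)
  have curve: "real_affine_point y \<in> curve q_dual \<longleftrightarrow> quintic 1 (complex_of_real s ^ 5) (complex_of_real t ^ 5) = 0"
    unfolding real_affine_point_eq
    by (subst proj_in_curve_iff[OF homogeneous_q_dual])
      (auto simp: hom_coords_eq_0_iff eval_q_dual st simp flip: of_real_power)
  show ?thesis
  proof
    assume "real_affine_point y \<in> curve q_dual"
    then obtain c where c: "c^5 = 1" "(complex_of_real s + c * complex_of_real t)^5 = 1"
      using curve quintic_eq_0_iff_fifth_powers by metis
    define w where "w = complex_of_real s + c * complex_of_real t"
    have "w \<noteq> 0" using c(2) by (auto simp flip: w_def)
    \<comment> \<open>Since w^5 = 1, division by w writes 1 as a combination of s and t with fifth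
      roots of unity as coefficients.\<close>
    have "inverse w * complex_of_real s + (inverse w * c) * complex_of_real t = inverse w * w"
      by (simp add: w_def algebra_simps)
    also have "\<dots> = 1" using \<open>w \<noteq> 0\<close> by simp
    finally have "s + t = 1 \<or> s = (sqrt 5 + 1) / 2 \<and> t = (sqrt 5 + 1) / 2"
      using c st by (intro nonneg_combination_of_fifth_roots)
        (simp_all add: power_mult_distrib power_inverse flip: w_def)
    then show "dual_gauge y = 1 \<or> y \<in> diagonal_points"
      using golden_power5 st by (metis mem_axis_diagonal_points_iff(2))
  next
    assume "dual_gauge y = 1 \<or> y \<in> diagonal_points"
    then show "real_affine_point y \<in> curve q_dual"
    proof
      assume "dual_gauge y = 1"
      then have "complex_of_real s + complex_of_real t = 1"
        by (simp add: st flip: of_real_add)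
      then show ?thesis
        unfolding curve using quintic_param[of "complex_of_real s" "complex_of_real t"] by simp
    next
      assume "y \<in> diagonal_points"
      then have "real_affine_point y \<in> singular_points q_dual"
        using real_affine_point_in_singular_points_iff by blast
      then show ?thesis by (auto simp: singular_points_def curve_def)
    qed
  qed
qed

lemma dual_gauge_diagonal_points: "y \<in> diagonal_points \<Longrightarrow> dual_gauge y > 1"
proof -
  assume "y \<in> diagonal_points"
  then have "(y $ 1)^6 = node_coord" by (simp add: mem_axis_diagonal_points_iff)
  have "root 5 (y $ 1)^6 > 1"
  proof (rule ccontr)
    assume "\<not> root 5 (y $ 1)^6 > 1"
    then have "(root 5 (y $ 1)^6)^5 \<le> 1^5" by (intro power_mono) (simp_all only: not_less zero_le_even_power even_numeral)
    moreover have "(root 5 (y $ 1)^6)^5 = (y $ 1)^6"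
      by (metis root5_power5 power_mult mult.commute)
    ultimately show False
      using \<open>(y $ 1)^6 = node_coord\<close> node_coord_bounds by simp
  qed
  moreover have "root 5 (y $ 2)^6 \<ge> 0" by simp
  ultimately show "dual_gauge y > 1" by (simp only: dual_gauge_def)
qed

lemma dual_gauge_axis_points: "y \<in> axis_points \<Longrightarrow> dual_gauge y = 1"
  by (auto simp: axis_points_def dual_gauge_def real_root_minus)

section \<open>Double tangents\<close>

text \<open>Equal to g exp(3 pi \<i> / 5) / \<omega> with the golden ratio g; its fifth power is
  therefore - g^5 / \<omega>^5 = - \<omega>.\<close>

definition tangency_coord :: complex where
  "tangency_coord = (- 1 + \<i> * of_real \<alpha>) / (2 * of_real \<omega>)"

lemma alpha_squared: "\<alpha>^2 = 5 + 2 * sqrt 5" and alpha_pos: "\<alpha> > 0"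
  by (simp_all add: \<alpha>_def add_pos_pos)

lemma tangency_coord_power5: "tangency_coord^5 = - of_real \<omega>"
proof -
  define A where "A = complex_of_real \<alpha>"
  define S where "S = complex_of_real (sqrt 5)"
  have poly: "(- 1 + j * A)^5 = - 16 * (11 + 5 * S)" if "A^2 = 5 + 2 * S" "S^2 = 5" "j^2 = - 1" for A S j :: complex
    using that by algebra
  have "A^2 = 5 + 2 * S"
    unfolding A_def S_def by (simp flip: of_real_power add: alpha_squared)
  moreover have "S^2 = 5"
    unfolding S_def by (simp flip: of_real_power)
  moreover have "\<i>^2 = - 1" by simp
  ultimately have "(- 1 + \<i> * A)^5 = - 16 * (11 + 5 * S)"
    by (rule poly)
  also have "\<dots> = - 32 * of_real (\<omega>^6)"
    by (simp add: omega_power6 node_coord_def S_def)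
  finally show ?thesis
    using omega_pos by (simp add: tangency_coord_def power_divide power_mult_distrib A_def eval_nat_numeral)
qed

lemma cnj_tangency_coord: "cnj tangency_coord = (- 1 - \<i> * of_real \<alpha>) / (2 * of_real \<omega>)"
  by (simp add: tangency_coord_def)

lemma tangency_coord_neq_cnj: "tangency_coord \<noteq> cnj tangency_coord"
  unfolding cnj_tangency_coord unfolding tangency_coord_def
  using alpha_pos omega_pos by (simp add: divide_simps)

text \<open>Both conjugates have fifth power - \<omega>, so the gradient points to a diagonal point.
  Their sum is - 1 / \<omega>, so their sixth powers add up to 1 and the point lies on the
  sextic.\<close>

lemma tangent_at_diagonal:
  fixes \<sigma> \<tau> :: complex
  assumes "\<sigma> = 1 \<or> \<sigma> = - 1" "\<tau> = 1 \<or> \<tau> = - 1" "x = tangency_coord \<or> x = cnj tangency_coord"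
  shows "tangent_at p_sextic (proj (hom_coords 1 (\<sigma> * x) (\<tau> * cnj x)))
    (proj (hom_coords 1 (\<sigma> * of_real \<omega>) (\<tau> * of_real \<omega>)))"
proof -
  have cnj5: "cnj tangency_coord^5 = - of_real \<omega>"
    using arg_cong[OF tangency_coord_power5, of cnj] by simp
  have sum: "tangency_coord + cnj tangency_coord = - 1 / of_real \<omega>"
    unfolding cnj_tangency_coord unfolding tangency_coord_def
    using omega_pos by (simp add: field_simps)
  have "z^6 = z * z^5" for z :: complex by (simp add: eval_nat_numeral)
  then have "tangency_coord^6 + cnj tangency_coord^6 = - (tangency_coord + cnj tangency_coord) * of_real \<omega>"
    by (simp add: cnj5 tangency_coord_power5 algebra_simps)
  also have "\<dots> = 1"
    unfolding sum using omega_pos by simp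
  finally have sum6: "tangency_coord^6 + cnj tangency_coord^6 = 1" .
  have "\<sigma>^5 = \<sigma>" "\<tau>^5 = \<tau>" "\<sigma>^6 = 1" "\<tau>^6 = 1"
    using assms(1,2) by auto
  then show ?thesis
    unfolding tangent_at_sextic_iff
    using assms(3) cnj5 tangency_coord_power5 sum6
    by (intro exI[of _ "hom_coords 1 (\<sigma> * x) (\<tau> * cnj x)"])
      (auto simp: hom_coords_eq_0_iff power_mult_distrib add.commute)
qed

lemma diagonal_pointsE:
  assumes "y \<in> diagonal_points"
  obtains \<sigma> \<tau> :: real where "\<sigma> = 1 \<or> \<sigma> = - 1" "\<tau> = 1 \<or> \<tau> = - 1" "y $ 1 = \<sigma> * \<omega>" "y $ 2 = \<tau> * \<omega>"
  using assms unfolding diagonal_points_def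
  by (elim insertE emptyE) (use that[of 1 1] that[of 1 "- 1"] that[of "- 1" 1] that[of "- 1" "- 1"] in simp_all)

lemma double_tangent_diagonal:
  assumes "y \<in> diagonal_points"
  shows "double_tangent p_sextic (polar (real_affine_point y))"
    and "real_affine_part (polar (real_affine_point y)) \<inter> {x. (x $ 1)^6 + (x $ 2)^6 < 1} \<noteq> {}"
proof -
  obtain \<sigma> \<tau> :: real where st: "\<sigma> = 1 \<or> \<sigma> = - 1" "\<tau> = 1 \<or> \<tau> = - 1" "y $ 1 = \<sigma> * \<omega>" "y $ 2 = \<tau> * \<omega>"
    using assms by (rule diagonal_pointsE)
  let ?x = "\<lambda>x. proj (hom_coords 1 (of_real \<sigma> * x) (of_real \<tau> * cnj x))"
  have y: "real_affine_point y = proj (hom_coords 1 (of_real \<sigma> * of_real \<omega>) (of_real \<tau> * of_real \<omega>))"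
    by (simp add: real_affine_point_eq st)
  have "tangent_at p_sextic (?x x) (real_affine_point y)"
    if "x = tangency_coord \<or> x = cnj tangency_coord" for x
    unfolding y using st(1,2) that by (intro tangent_at_diagonal) auto
  then have "line_tangent_at p_sextic (polar (real_affine_point y)) (?x tangency_coord)"
    "line_tangent_at p_sextic (polar (real_affine_point y)) (?x (cnj tangency_coord))"
    unfolding line_tangent_at_def by blast+
  moreover have "?x tangency_coord \<noteq> ?x (cnj tangency_coord)"
    using affine_point_eq_iff[of "vector [of_real \<sigma> * tangency_coord, of_real \<tau> * cnj tangency_coord]"
        "vector [of_real \<sigma> * cnj tangency_coord, of_real \<tau> * tangency_coord]"]
      tangency_coord_neq_cnj st(1) by (auto simp: affine_point_def vec_eq_iff forall_2)
  ultimately show "double_tangent p_sextic (polar (real_affine_point y))"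
    unfolding double_tangent_def by blast
  \<comment> \<open>The midpoint of the two conjugate points of contact, which is real and lies on
    the line.\<close>
  define x :: "real ^ 2" where "x = vector [- \<sigma> / (2 * \<omega>), - \<tau> / (2 * \<omega>)]"
  have "real_affine_point x \<in> polar (real_affine_point y)"
    unfolding y using st(1,2) omega_pos
    by (subst real_affine_point_in_polar_iff) (auto simp: hom_coords_eq_0_iff x_def)
  moreover have "(x $ 1)^6 + (x $ 2)^6 = 1 / (32 * node_coord)"
    using st(1,2) by (auto simp: x_def power_divide power_mult_distrib omega_power6)
  then have "(x $ 1)^6 + (x $ 2)^6 < 1"
    using node_coord_bounds by (simp only: divide_less_eq_1) simp
  ultimately show "real_affine_part (polar (real_affine_point y)) \<inter> {x. (x $ 1)^6 + (x $ 2)^6 < 1} \<noteq> {}"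
    by (auto simp: real_affine_part_def)
qed

theorem mainTheorem1:
  fixes W :: "(real ^ 2) set" and C :: "(real ^ 2) set"
  assumes "compact W" and "convex W" and "W \<noteq> {}"
    and "\<And>x. support_fun W x = - root 6 ((x $ 1) ^ 6 + (x $ 2) ^ 6)"
    and "C = real_affine_part (dual_curve p_sextic)"
  shows
    "(\<comment> \<open>(i)\<close>
      (\<forall>x. x \<noteq> 0 \<longrightarrow>
        (let z = proj (hom_coords (of_real (- support_fun W x)) (of_real (x $ 1)) (of_real (x $ 2)))
         in (\<forall>z'. is_pole_of_real_affine_line z' (supporting_line W x) \<longleftrightarrow> z' = z)
            \<and> z \<in> curve p_sextic)) \<and>
      real_affine_part (curve p_sextic) = {x. (x $ 1) ^ 6 + (x $ 2) ^ 6 = 1} \<and>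
      real_affine_point ` {x. (x $ 1) ^ 6 + (x $ 2) ^ 6 = 1}
        = {z. \<exists>x. x \<noteq> 0 \<and> is_pole_of_real_affine_line z (supporting_line W x)}) \<and>
     (\<comment> \<open>(ii)\<close>
      irreducible q_dual \<and> homogeneous 30 q_dual \<and> dual_curve p_sextic = curve q_dual) \<and>
     (\<comment> \<open>(iii); 228 counts the singular points in the affine plane, off the line \<open>y0 = 0\<close>\<close>
      \<bar>\<omega> - 1.49\<bar> < 0.005 \<and>
      card (singular_points q_dual \<inter> range affine_point) = 228 \<and>
      card {z \<in> singular_points q_dual. is_real z} = 8 \<and>
      {z \<in> singular_points q_dual. is_real z}
        = real_affine_point ` (axis_points \<union> diagonal_points)) \<and>
     (\<comment> \<open>(iv)\<close>
      C = frontier W \<union> diagonal_points \<and>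
      axis_points \<subseteq> frontier W \<and>
      (\<forall>y\<in>diagonal_points. y isolated_in C \<and> real_affine_point y \<in> singular_points q_dual)) \<and>
     (\<comment> \<open>(v)\<close>
      diagonal_points \<inter> W = {} \<and> W \<noteq> convex hull C) \<and>
     (\<comment> \<open>(vi)\<close>
      (\<forall>y\<in>diagonal_points.
         real_line (polar (real_affine_point y)) \<and>
         double_tangent p_sextic (polar (real_affine_point y)) \<and>
         real_affine_part (polar (real_affine_point y)) \<inter> {x. (x $ 1) ^ 6 + (x $ 2) ^ 6 < 1} \<noteq> {}) \<and>
      (let l = polar (proj (hom_coords 1 (of_real \<omega>) (of_real \<omega>)));
           x = (1 / (2 * of_real \<omega>)) *s vector [-1 + \<i> * of_real \<alpha>, -1 - \<i> * of_real \<alpha>];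
           x' = (1 / (2 * of_real \<omega>)) *s vector [-1 - \<i> * of_real \<alpha>, -1 + \<i> * of_real \<alpha>]
       in x' = (\<chi> i. cnj (x $ i)) \<and> x \<noteq> x' \<and>
          line_tangent_at p_sextic l (affine_point x) \<and>
          line_tangent_at p_sextic l (affine_point x')))"
proof (intro conjI)
  note support = assms(4)
  have W: "W = {y. dual_gauge y \<le> 1}" "frontier W = {y. dual_gauge y = 1}"
    using W_eq_dual_gauge[OF assms(1-4)] frontier_W[OF assms(1-4)] by auto
  have C: "C = frontier W \<union> diagonal_points"
    unfolding W(2) assms(5) dual_curve_sextic real_affine_part_def
    using real_affine_point_in_dual_curve_iff by auto
  have norm_pos: "root 6 ((x $ 1)^6 + (x $ 2)^6) > 0" if "x \<noteq> 0" for x :: "real ^ 2"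
  proof -
    have "(x $ 1)^6 + (x $ 2)^6 \<noteq> 0"
      using that add_nonneg_eq_0_iff[of "(x $ 1)^6" "(x $ 2)^6"] by (auto simp: vec_eq_iff forall_2)
    then show ?thesis
      by (simp add: order_less_le)
  qed
  have line: "supporting_line W x = {y. x \<bullet> y = - (- support_fun W x)}" for x
    by (simp add: supporting_line_def)
  have pole: "is_pole_of_real_affine_line z (supporting_line W x) \<longleftrightarrow>
      z = proj (hom_coords (of_real (- support_fun W x)) (of_real (x $ 1)) (of_real (x $ 2)))"
    if "x \<noteq> 0" for x z
    unfolding line by (rule is_pole_of_real_affine_line_iff[OF that])
  \<comment> \<open>Dividing by minus the support function brings the pole into the chart x0 = 1,
    where it lies on the real sextic.\<close>
  have normalize: "proj (hom_coords (of_real (- support_fun W x)) (of_real (x $ 1)) (of_real (x $ 2)))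
      = real_affine_point ((1 / - support_fun W x) *\<^sub>R x)" if "x \<noteq> 0" for x
  proof -
    have "hom_coords (of_real (- support_fun W x)) (of_real (x $ 1)) (of_real (x $ 2))
        = of_real (- support_fun W x) *s
          hom_coords 1 (of_real (((1 / - support_fun W x) *\<^sub>R x) $ 1)) (of_real (((1 / - support_fun W x) *\<^sub>R x) $ 2))"
      using norm_pos[OF that] by (simp add: vec3_eq_iff support)
    then show ?thesis
      using norm_pos[OF that] by (simp add: real_affine_point_eq proj_smult hom_coords_eq_0_iff support)
  qed
  have normalized: "(((1 / - support_fun W x) *\<^sub>R x) $ 1)^6 + (((1 / - support_fun W x) *\<^sub>R x) $ 2)^6 = 1"
    if "x \<noteq> 0" for x
  proof -
    have "root 6 ((x $ 1)^6 + (x $ 2)^6) ^ 6 = (x $ 1)^6 + (x $ 2)^6"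
      by simp
    with norm_pos[OF that] show ?thesis
      by (simp add: support power_divide flip: add_divide_distrib)
  qed
  show "\<forall>x. x \<noteq> 0 \<longrightarrow>
      (let z = proj (hom_coords (of_real (- support_fun W x)) (of_real (x $ 1)) (of_real (x $ 2)))
       in (\<forall>z'. is_pole_of_real_affine_line z' (supporting_line W x) \<longleftrightarrow> z' = z) \<and> z \<in> curve p_sextic)"
    unfolding Let_def
    using pole normalize normalized real_affine_point_in_sextic_iff by metis
  show "real_affine_part (curve p_sextic) = {x. (x $ 1) ^ 6 + (x $ 2) ^ 6 = 1}"
    by (simp add: real_affine_part_def real_affine_point_in_sextic_iff)
  show "real_affine_point ` {x. (x $ 1) ^ 6 + (x $ 2) ^ 6 = 1}
      = {z. \<exists>x. x \<noteq> 0 \<and> is_pole_of_real_affine_line z (supporting_line W x)}"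
  proof (intro set_eqI iffI)
    fix z assume "z \<in> real_affine_point ` {x. (x $ 1) ^ 6 + (x $ 2) ^ 6 = 1}"
    then obtain x where x: "(x $ 1) ^ 6 + (x $ 2) ^ 6 = 1" "z = real_affine_point x" by blast
    then have "x \<noteq> 0" by auto
    moreover have "support_fun W x = - 1"
      by (simp add: support x(1))
    ultimately show "z \<in> {z. \<exists>x. x \<noteq> 0 \<and> is_pole_of_real_affine_line z (supporting_line W x)}"
      using pole[of x z] by (auto simp: x(2) real_affine_point_eq)
  next
    fix z assume "z \<in> {z. \<exists>x. x \<noteq> 0 \<and> is_pole_of_real_affine_line z (supporting_line W x)}"
    then obtain x where "x \<noteq> 0" "z = real_affine_point ((1 / - support_fun W x) *\<^sub>R x)"
      using pole normalize by auto
    with normalized show "z \<in> real_affine_point ` {x. (x $ 1) ^ 6 + (x $ 2) ^ 6 = 1}"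
      by blast
  qed
  show "irreducible q_dual" "homogeneous 30 q_dual" "dual_curve p_sextic = curve q_dual"
    by (rule irreducible_q_dual homogeneous_q_dual dual_curve_sextic)+
  show "\<bar>\<omega> - 1.49\<bar> < 0.005" "card (singular_points q_dual \<inter> range affine_point) = 228"
    "card {z \<in> singular_points q_dual. is_real z} = 8"
    "{z \<in> singular_points q_dual. is_real z} = real_affine_point ` (axis_points \<union> diagonal_points)"
    by (rule omega_approx card_affine_singular_points card_real_singular_points real_singular_points)+
  show "C = frontier W \<union> diagonal_points" by (rule C)
  show "axis_points \<subseteq> frontier W"
    using dual_gauge_axis_points by (auto simp: W(2))
  have diag: "y \<notin> frontier W" "y \<notin> W" if "y \<in> diagonal_points" for y
    using dual_gauge_diagonal_points[OF that] by (simp add: W(2), simp add: W(1))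
  show "\<forall>y\<in>diagonal_points. y isolated_in C \<and> real_affine_point y \<in> singular_points q_dual"
  proof
    fix y assume y: "y \<in> diagonal_points"
    \<comment> \<open>Removing one point from the finite diagonal set leaves a closed set, whose
      complement is the isolating neighbourhood.\<close>
    have "closed (frontier W \<union> (diagonal_points - {y}))"
      by (intro closed_Un frontier_closed finite_imp_closed) (simp add: diagonal_points_def)
    then have "open (- (frontier W \<union> (diagonal_points - {y})))" by (rule open_Compl)
    moreover have "- (frontier W \<union> (diagonal_points - {y})) \<inter> C = {y}"
      using y diag by (auto simp: C)
    ultimately have "y isolated_in C"
      using y by (auto simp: isolated_in_def C)
    moreover have "real_affine_point y \<in> singular_points q_dual"
      using y by (simp add: real_affine_point_in_singular_points_iff)
    ultimately show "y isolated_in C \<and> real_affine_point y \<in> singular_points q_dual" ..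
  qed
  show "diagonal_points \<inter> W = {}"
    using diag by auto
  have omega_point: "vector [\<omega>, \<omega>] \<in> diagonal_points"
    by (simp add: diagonal_points_def)
  then have "vector [\<omega>, \<omega>] \<in> convex hull C"
    by (simp add: C hull_inc)
  with diag omega_point show "W \<noteq> convex hull C" by blast
  show "\<forall>y\<in>diagonal_points.
      real_line (polar (real_affine_point y)) \<and>
      double_tangent p_sextic (polar (real_affine_point y)) \<and>
      real_affine_part (polar (real_affine_point y)) \<inter> {x. (x $ 1) ^ 6 + (x $ 2) ^ 6 < 1} \<noteq> {}"
    using double_tangent_diagonal is_real_real_affine_point unfolding real_line_def by blast
  let ?l = "polar (proj (hom_coords 1 (of_real \<omega>) (of_real \<omega>)))"
  let ?x = "(1 / (2 * of_real \<omega>)) *s vector [-1 + \<i> * of_real \<alpha>, -1 - \<i> * of_real \<alpha>] :: complex ^ 2"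
  let ?x' = "(1 / (2 * of_real \<omega>)) *s vector [-1 - \<i> * of_real \<alpha>, -1 + \<i> * of_real \<alpha>] :: complex ^ 2"
  have x: "?x $ 1 = tangency_coord" "?x $ 2 = cnj tangency_coord"
    "?x' $ 1 = cnj tangency_coord" "?x' $ 2 = tangency_coord"
    by (simp_all add: tangency_coord_def)
  have tangent: "line_tangent_at p_sextic ?l (affine_point ?x)" "line_tangent_at p_sextic ?l (affine_point ?x')"
    unfolding line_tangent_at_def affine_point_def x
    using tangent_at_diagonal[of 1 1 tangency_coord] tangent_at_diagonal[of 1 1 "cnj tangency_coord"] by auto
  have "?x' = (\<chi> i. cnj (?x $ i))"
    unfolding vec_eq_iff forall_2 vec_lambda_beta x by simp
  moreover have "?x \<noteq> ?x'"
    using tangency_coord_neq_cnj x by metis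
  ultimately show "let l = ?l; x = ?x; x' = ?x'
      in x' = (\<chi> i. cnj (x $ i)) \<and> x \<noteq> x' \<and>
         line_tangent_at p_sextic l (affine_point x) \<and> line_tangent_at p_sextic l (affine_point x')"
    unfolding Let_def using tangent by blast
qed

end
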